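(* Suppose the weight sequence $\mathbf{w}$ has type I and the offspring variable $\xi$ has finite variance. Let $(k_n)$ be any sequence of non-negative integers with $k_n/\sqrt{n}\to0$, and let $v_0$ be a uniformly random vertex of $\mathcal{T}_n$. Then $$d_{\mathrm{TV}}\big(H_{k_n}(\mathcal{T}_n,v_0),\,H_{k_n}(\mathcal{T}^*,u_0)\big)\to0\quad (n\to\infty).$$
   Context: A weight sequence $\mathbf{w}=(\omega_k)_{k\ge0}$ consists of non-negative reals with $\omega_0>0$ and $\omega_k>0$ for some $k\ge2$; $\mathrm{span}(\mathbf{w})=\gcd\{i:\omega_i>0\}$. $\mathcal{T}_n$ is the random plane tree with $n$ vertices drawn with probability proportional to $\prod_{v}\omega_{d^+(v)}$ ($n\equiv1\bmod\mathrm{span}(\mathbf{w})$). With $\phi(z)=\sum_k\omega_kz^k$, radius $\rho_\phi$, $\psi(t)=t\phi'(t)/\phi(t)$, $\nu=\lim_{t\nearrow\rho_\phi}\psi(t)$: type I means $\rho_\phi>0$ and $\nu\ge1$, and then $\tau$ is the unique number with $\psi(\tau)=1$. $\xi$ has law $\Pr{\xi=k}=\tau^k\omega_k/\phi(\tau)$ (mean $1$ in type I), $\mathcal{T}$ is a Galton–Watson tree with offspring law $\xi$, and $\hat\xi$ is size-biased: $\Pr{\hat\xi=k}=k\Pr{\xi=k}$. $\mathcal{T}^*$: spine $u_0,u_1,\dots$ with $u_i$ the parent of $u_{i-1}$; $u_0$ is the root of an independent copy of $\mathcal{T}$; each $u_i$, $i\ge1$, has an independent copy of $\hat\xi$ many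 ordered children, one chosen uniformly at random being $u_{i-1}$, all others roots of independent copies of $\mathcal{T}$. $\mathcal{T}^*$ is pointed at $u_0$. For a plane tree $T$ (or $\mathcal{T}^*$), a vertex $v$ and $k\ge0$: if $v$ has a $k$-th ancestor $v_k$, $H_k(T,v)$ is the fringe subtree of $T$ rooted at $v_k$ (the maximal subtree consisting of $v_k$ and its descendants), viewed as a plane tree pointed at $v$; if $\mathrm{h}_T(v)<k$, $H_k(T,v)=\diamond$ for a fixed placeholder $\diamond$. Total variation distance is over the countable set of finite pointed plane trees together with $\diamond$. *)

theory Defs
  imports "HOL-Probability.Probability"
begin

datatype ptree = Node "ptree list"

fun children :: "ptree \<Rightarrow> ptree list" where
  "children (Node ts) = ts"

fun tsize :: "ptree \<Rightarrow> nat" where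
  "tsize (Node ts) = Suc (sum_list (map tsize ts))"

text \<open>Vertices are addressed by their path from the root (list of child indices,
  the root being []).  The length of the path is the height of the vertex.\<close>
inductive is_vertex :: "ptree \<Rightarrow> nat list \<Rightarrow> bool" where
  root: "is_vertex t []"
| child: "i < length ts \<Longrightarrow> is_vertex (ts ! i) p \<Longrightarrow> is_vertex (Node ts) (i # p)"

definition vertices :: "ptree \<Rightarrow> nat list set" where
  "vertices t = {p. is_vertex t p}"

definition subtree :: "ptree \<Rightarrow> nat list \<Rightarrow> ptree" where
  "subtree t p = fold (\<lambda>i s. children s ! i) p t"

type_synonym pointed_tree = "ptree \<times> nat list"

text \<open>H_k(T,v): the fringe subtree rooted at the k-th ancestor of v, pointed at v;
  None plays the role of the placeholder \<diamond> (when the height of v is < k).\<close>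
definition H :: "nat \<Rightarrow> ptree \<Rightarrow> nat list \<Rightarrow> pointed_tree option" where
  "H k t v = (if length v < k then None
              else Some (subtree t (take (length v - k) v), drop (length v - k) v))"

fun tweight :: "(nat \<Rightarrow> real) \<Rightarrow> ptree \<Rightarrow> real" where
  "tweight w (Node ts) = w (length ts) * prod_list (map (tweight w) ts)"

definition weight_sequence :: "(nat \<Rightarrow> real) \<Rightarrow> bool" where
  "weight_sequence w \<longleftrightarrow> (\<forall>k. 0 \<le> w k) \<and> 0 < w 0 \<and> (\<exists>k\<ge>2. 0 < w k)"

definition span :: "(nat \<Rightarrow> real) \<Rightarrow> nat" where
  "span w = Gcd {i. 0 < w i}"

definition Zn :: "(nat \<Rightarrow> real) \<Rightarrow> nat \<Rightarrow> real" where
  "Zn w n = (\<Sum>t\<in>{t. tsize t = n}. tweight w t)"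

definition Tn :: "(nat \<Rightarrow> real) \<Rightarrow> nat \<Rightarrow> ptree pmf" where
  "Tn w n = embed_pmf (\<lambda>t. if tsize t = n then tweight w t / Zn w n else 0)"

definition H_Tn :: "(nat \<Rightarrow> real) \<Rightarrow> nat \<Rightarrow> nat \<Rightarrow> pointed_tree option pmf" where
  "H_Tn w n k = do { t \<leftarrow> Tn w n; v \<leftarrow> pmf_of_set (vertices t); return_pmf (H k t v) }"

definition phi :: "(nat \<Rightarrow> real) \<Rightarrow> real \<Rightarrow> real" where
  "phi w t = (\<Sum>k. w k * t ^ k)"

definition dphi :: "(nat \<Rightarrow> real) \<Rightarrow> real \<Rightarrow> real" where
  "dphi w t = (\<Sum>k. real k * w k * t ^ (k - 1))"

definition psi :: "(nat \<Rightarrow> real) \<Rightarrow> real \<Rightarrow> real" where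
  "psi w t = t * dphi w t / phi w t"

definition offspring :: "(nat \<Rightarrow> real) \<Rightarrow> real \<Rightarrow> nat \<Rightarrow> real" where
  "offspring w \<tau> k = \<tau> ^ k * w k / phi w \<tau>"

text \<open>Galton--Watson tree with offspring law p, as a law on finite plane trees:
  Pr(T = t) = product over vertices of p(outdegree).\<close>
definition GW :: "(nat \<Rightarrow> real) \<Rightarrow> ptree pmf" where
  "GW p = embed_pmf (tweight p)"

definition size_biased :: "(nat \<Rightarrow> real) \<Rightarrow> nat pmf" where
  "size_biased p = embed_pmf (\<lambda>k. real k * p k)"

text \<open>Law of H_k(T*, u_0) = fringe subtree of T* at the spine vertex u_k, pointed at u_0,
  built literally along the spine: u_0 is the root of a GW tree; u_i (i \<ge> 1) gets
  a size-biased number d of children, a uniform one of them (index j) being u_{i-1},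
  the others roots of independent GW trees.\<close>
fun Hstar :: "(nat \<Rightarrow> real) \<Rightarrow> nat \<Rightarrow> pointed_tree pmf" where
  "Hstar p 0 = map_pmf (\<lambda>t. (t, [])) (GW p)"
| "Hstar p (Suc i) = do {
      d \<leftarrow> size_biased p;
      j \<leftarrow> pmf_of_set {..<d};
      tv \<leftarrow> Hstar p i;
      ts \<leftarrow> replicate_pmf d (GW p);
      return_pmf (Node (ts[j := fst tv]), j # snd tv) }"

definition dTV :: "'a pmf \<Rightarrow> 'a pmf \<Rightarrow> real" where
  "dTV P Q = (SUP A. \<bar>measure_pmf.prob P A - measure_pmf.prob Q A\<bar>)"

end

theory Submission
  imports Defs "HOL-Computational_Algebra.Formal_Power_Series"
begin

text \<open>
  Write \<open>p\<close> for the law of \<open>\<xi>\<close>, \<open>S\<^sub>n\<close> for a sum of \<open>n\<close> independent copies of \<open>\<xi>\<close>, and \<open>p(t)\<close> for the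
  Galton--Watson weight of a finite tree \<open>t\<close> with \<open>m\<close> vertices. Both laws are explicit: for \<open>v\<close> of
  height \<open>k\<close> in \<open>t\<close>, size-biasing telescopes along the spine, so that \<open>H\<^sub>k(T*,u\<^sub>0) = (t,v)\<close> has probability
  \<open>p(t)\<close>, while removing roots from forests one at a time shows that \<open>H\<^sub>k(T\<^sub>n,v\<^sub>0) = (t,v)\<close> has probability
  \<open>p(t) \<cdot> P(S\<^sub>n\<^sub>-\<^sub>m = n-m) / P(S\<^sub>n = n-1)\<close>. By the local limit theorem this ratio is at least \<open>1 - \<delta>\<close> as soon
  as \<open>m \<le> n/2\<close> and \<open>n\<close> is large, which bounds the total variation distance by \<open>\<delta>\<close> plus the probability that
  \<open>H\<^sub>k(T*,u\<^sub>0)\<close> has more than \<open>n/2\<close> vertices. The latter is \<open>O((k+1)/\<surd>n)\<close>: the generating function \<open>f\<close> of the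
  total progeny satisfies \<open>f(s) = s \<phi>(f(s))\<close>, hence \<open>1 - f(s) = O(\<surd>(1-s))\<close>, and the spine carries on average
  \<open>1 + k Var \<xi>\<close> independent Galton--Watson trees.
\<close>

subsection \<open>Coefficients of powers of the offspring series\<close>

text \<open>When \<open>p\<close> is a probability law this is P(S_n = j). Read as a coefficient of
  a formal power series, it obeys algebraic identities in which no convergence is involved.\<close>

definition walk :: "(nat \<Rightarrow> real) \<Rightarrow> nat \<Rightarrow> nat \<Rightarrow> real" where
  "walk p n j = fps_nth (Abs_fps p ^ n) j"

lemma walk_0: "walk p 0 j = (if j = 0 then 1 else 0)"
  by (simp add: walk_def)

lemma walk_Suc: "walk p (Suc n) j = (\<Sum>k\<le>j. p k * walk p n (j - k))"
  by (simp add: walk_def fps_mult_nth atMost_atLeast0)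

lemma walk_nonneg: "(\<And>k. 0 \<le> p k) \<Longrightarrow> 0 \<le> walk p n j"
  by (induction n arbitrary: j) (auto simp: walk_0 walk_Suc intro!: sum_nonneg)

text \<open>Compare coefficients in X (f^(n+1))' = (n+1) (X f') f^n. In probabilistic terms: given
  that n+1 exchangeable summands add up to j, each of them has mean j/(n+1).\<close>

lemma walk_size_bias:
  "real (Suc n) * (\<Sum>k\<le>j. real k * p k * walk p n (j - k)) = real j * walk p (Suc n) j"
proof -
  let ?f = "Abs_fps p"
  have eq: "Abs_fps (\<lambda>k. real k * p k) = fps_X * fps_deriv ?f"
  proof (rule fps_ext)
    fix k show "fps_nth (Abs_fps (\<lambda>k. real k * p k)) k = fps_nth (fps_X * fps_deriv ?f) k"
      by (cases k) auto
  qed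
  have "real j * walk p (Suc n) j = fps_nth (fps_X * fps_deriv (?f ^ Suc n)) j"
    by (cases j) (auto simp: walk_def simp del: power_Suc)
  also have "fps_X * fps_deriv (?f ^ Suc n)
      = fps_const (real (Suc n)) * ((fps_X * fps_deriv ?f) * ?f ^ n)"
    unfolding fps_deriv_power by (simp add: mult_ac)
  also have "fps_nth \<dots> j = real (Suc n) * fps_nth ((fps_X * fps_deriv ?f) * ?f ^ n) j"
    by simp
  also have "fps_nth ((fps_X * fps_deriv ?f) * ?f ^ n) j
      = (\<Sum>k\<le>j. real k * p k * walk p n (j - k))"
    unfolding eq[symmetric] by (simp add: fps_mult_nth walk_def atMost_atLeast0)
  finally show ?thesis ..
qed

lemma walk_nonzero_dvd:
  assumes "\<And>k. p k \<noteq> 0 \<Longrightarrow> d dvd k" and "walk p n j \<noteq> 0"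
  shows "d dvd j"
  using assms(2)
proof (induction n arbitrary: j)
  case 0
  then show ?case by (auto simp: walk_0 split: if_splits)
next
  case (Suc n)
  then obtain k where k: "k \<le> j" "p k * walk p n (j - k) \<noteq> 0"
    by (auto simp: walk_Suc elim: sum.not_neutral_contains_not_neutral)
  then have "d dvd k" "d dvd j - k" using Suc.IH assms(1) by auto
  then show ?case using k(1) by (metis dvd_add le_add_diff_inverse)
qed

subsection \<open>Weighted forests\<close>

definition forests :: "nat \<Rightarrow> nat \<Rightarrow> ptree list set" where
  "forests n r = {ts. length ts = r \<and> sum_list (map tsize ts) = n}"

lemma tsize_pos: "0 < tsize t"
  by (cases t) simp

lemma length_le_forest_size: "length ts \<le> sum_list (map tsize ts)"
proof (induction ts)
  case (Cons t ts)
  then show ?case using tsize_pos[of t] by simp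
qed simp

lemma forests_0_right: "forests n 0 = (if n = 0 then {[]} else {})"
  by (auto simp: forests_def)

lemma forests_empty: "n < r \<Longrightarrow> forests n r = {}"
  using length_le_forest_size by (auto simp: forests_def not_less[symmetric])

text \<open>Undoes the deletion of the root of the first tree: \<open>k\<close> records how many of
  the remaining trees \<open>us\<close> were its children, which the list alone does not
  reveal.\<close>

definition unroot :: "nat \<times> ptree list \<Rightarrow> ptree list" where
  "unroot = (\<lambda>(k, us). Node (take k us) # drop k us)"

text \<open>Delete the root of the first tree and put its children in front of the other trees. The
  degree of that root is at most n because every child subtree has a vertex.\<close>

lemma forests_Suc:
  "forests (Suc n) (Suc r) = unroot ` (SIGMA k:{..n}. forests n (r + k))" (is "?L = ?R")
proof
  show "?L \<subseteq> ?R"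
  proof
    fix ts assume "ts \<in> ?L"
    then obtain T rest where "ts = T # rest" "length rest = r"
        "tsize T + sum_list (map tsize rest) = Suc n"
      by (auto simp: forests_def length_Suc_conv)
    moreover obtain cs where "T = Node cs" by (cases T)
    ultimately have ts: "ts = Node cs # rest"
      and *: "length rest = r" "sum_list (map tsize cs) + sum_list (map tsize rest) = n"
      by auto
    have "ts = unroot (length cs, cs @ rest)" by (simp add: ts unroot_def)
    moreover have "length cs \<le> n" using length_le_forest_size[of cs] *(2) by simp
    ultimately show "ts \<in> ?R" using * by (auto simp: forests_def intro!: image_eqI)
  qed
  show "?R \<subseteq> ?L"
  proof
    fix ts assume "ts \<in> ?R"
    then obtain k us where k: "us \<in> forests n (r + k)" "ts = unroot (k, us)" by auto
    have "sum_list (map tsize (take k us @ drop k us)) = n"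
      using k by (simp add: forests_def)
    then show "ts \<in> ?L" using k
      unfolding map_append sum_list_append by (simp add: unroot_def forests_def)
  qed
qed

lemma inj_on_unroot: "inj_on unroot (SIGMA k:{..n}. forests n (r + k))"
proof (rule inj_onI)
  fix x y assume "x \<in> (SIGMA k:{..n}. forests n (r + k))" "y \<in> (SIGMA k:{..n}. forests n (r + k))"
    and eq: "unroot x = unroot y"
  then obtain k us l vs where x: "x = (k, us)" "length us = r + k"
    and y: "y = (l, vs)" "length vs = r + l" by (auto simp: forests_def)
  have *: "take k us = take l vs" "drop k us = drop l vs" using eq by (auto simp: x y unroot_def)
  then have "us = vs" by (metis append_take_drop_id)
  then show "x = y" using x y by simp
qed

lemma finite_forests: "finite (forests n r)"
proof (induction n arbitrary: r)
  case 0
  then show ?case by (cases r) (auto simp: forests_0_right forests_empty)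
next
  case (Suc n)
  then show ?case by (cases r) (auto simp: forests_0_right forests_Suc)
qed

lemma sum_forests_Suc:
  "(\<Sum>ts\<in>forests (Suc n) (Suc r). f ts) = (\<Sum>k\<le>n. \<Sum>us\<in>forests n (r + k). f (Node (take k us) # drop k us))"
  by (simp add: forests_Suc sum.reindex inj_on_unroot sum.Sigma finite_forests)
     (simp add: unroot_def case_prod_unfold)

definition fweight :: "(nat \<Rightarrow> real) \<Rightarrow> ptree list \<Rightarrow> real" where
  "fweight p ts = prod_list (map (tweight p) ts)"

lemma fweight_unroot:
  assumes "k \<le> length us"
  shows "fweight p (Node (take k us) # drop k us) = p k * fweight p us"
proof -
  have "fweight p us = fweight p (take k us @ drop k us)" by simp
  also have "\<dots> = fweight p (take k us) * fweight p (drop k us)"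
    unfolding fweight_def map_append prod_list.append ..
  finally show ?thesis using assms by (simp add: fweight_def mult.assoc min_absorb2)
qed

definition forest_sum :: "(nat \<Rightarrow> real) \<Rightarrow> nat \<Rightarrow> nat \<Rightarrow> real" where
  "forest_sum p n r = (\<Sum>ts\<in>forests n r. fweight p ts)"

lemma forest_sum_Suc: "forest_sum p (Suc n) (Suc r) = (\<Sum>k\<le>n. p k * forest_sum p n (r + k))"
  unfolding forest_sum_def sum_forests_Suc sum_distrib_left
  by (intro sum.cong refl fweight_unroot) (auto simp: forests_def)

text \<open>The induction step shared by both counting formulas below. The factor r + k is split:
  the part r is the convolution \<open>walk_Suc\<close>, the part k is
  \<open>walk_size_bias\<close>.\<close>

lemma sum_walk_shift:
  "real (Suc n) * (\<Sum>k\<le>j. p k * (real (r + k) * walk p n (j - k)))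
     = (real (Suc n) * real r + real j) * walk p (Suc n) j"
proof -
  have "(\<Sum>k\<le>j. p k * (real (r + k) * walk p n (j - k)))
      = real r * (\<Sum>k\<le>j. p k * walk p n (j - k)) + (\<Sum>k\<le>j. real k * p k * walk p n (j - k))"
    by (simp add: sum_distrib_left sum.distrib[symmetric] algebra_simps)
  then show ?thesis
    using walk_size_bias[of n p j] by (simp add: walk_Suc[symmetric] distrib_left distrib_right)
qed

text \<open>The Otter-Dwass formula, proved by deleting one root at a time rather than by the cycle
  lemma. The factor n is kept on the left so that no division occurs.\<close>

lemma forest_sum_walk:
  "r \<le> n \<Longrightarrow> real n * forest_sum p n r = real r * walk p n (n - r)"
proof (induction n arbitrary: r)
  case 0
  then show ?case by simp
next
  case (Suc n)
  show ?case
  proof (cases r)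
    case 0
    then show ?thesis by (simp add: forest_sum_def forests_0_right)
  next
    case r: (Suc r')
    show ?thesis
    \<comment> \<open>The induction hypothesis at 0 reads 0 = 0, so a forest with a single vertex is
      computed by hand.\<close>
    proof (cases n)
      case 0
      then show ?thesis using r Suc.prems
        by (simp add: forest_sum_Suc) (simp add: forest_sum_def forests_0_right fweight_def walk_Suc walk_0)
    next
      case n: (Suc n')
      define j where "j = n - r'"
      have j: "n = r' + j" using Suc.prems r by (simp add: j_def)
      have "real n * forest_sum p (Suc n) (Suc r')
          = (\<Sum>k\<le>n. p k * (real n * forest_sum p n (r' + k)))"
        by (simp add: forest_sum_Suc sum_distrib_left mult_ac)
      \<comment> \<open>For k > j there would be more trees than vertices.\<close>
      also have "\<dots> = (\<Sum>k\<le>j. p k * (real n * forest_sum p n (r' + k)))"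
        by (rule sum.mono_neutral_right) (auto simp: forest_sum_def forests_empty j)
      also have "\<dots> = (\<Sum>k\<le>j. p k * (real (r' + k) * walk p n (j - k)))"
        by (intro sum.cong refl) (subst Suc.IH, auto simp: j)
      finally have "real (Suc n) * (real n * forest_sum p (Suc n) (Suc r'))
         = (real (Suc n) * real r' + real j) * walk p (Suc n) j"
        using sum_walk_shift[of n p r' j] by simp
      also have "real (Suc n) * real r' + real j = real n * real (Suc r')"
        by (simp add: j algebra_simps)
      finally have "real n * (real (Suc n) * forest_sum p (Suc n) (Suc r'))
          = real n * (real (Suc r') * walk p (Suc n) j)" by (simp only: mult_ac)
      then have "real (Suc n) * forest_sum p (Suc n) (Suc r') = real (Suc r') * walk p (Suc n) j"
        using n by (simp del: of_nat_Suc)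
      then show ?thesis by (simp add: r j_def)
    qed
  qed
qed

section \<open>Vertices, fringe subtrees and their occurrences\<close>

lemma vertices_Node: "vertices (Node ts) = insert [] (\<Union>i<length ts. (#) i ` vertices (ts ! i))"
proof -
  have "is_vertex (Node ts) x \<longleftrightarrow> x = [] \<or> (\<exists>i<length ts. \<exists>u. x = i # u \<and> is_vertex (ts ! i) u)" for x
    by (subst is_vertex.simps) auto
  then show ?thesis by (auto simp: vertices_def)
qed

lemma root_in_vertices [simp]: "[] \<in> vertices t"
  by (simp add: vertices_def is_vertex.root)

lemma Cons_in_vertices:
  "i # p \<in> vertices t \<longleftrightarrow> i < length (children t) \<and> p \<in> vertices (children t ! i)"
  by (cases t) (auto simp: vertices_Node)

lemma subtree_Nil [simp]: "subtree t [] = t"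
  by (simp add: subtree_def)

lemma subtree_Cons: "subtree t (i # p) = subtree (children t ! i) p"
  by (simp add: subtree_def)

lemma append_in_vertices: "p @ q \<in> vertices t \<longleftrightarrow> p \<in> vertices t \<and> q \<in> vertices (subtree t p)"
  by (induction p arbitrary: t) (auto simp: Cons_in_vertices subtree_Cons)

lemma finite_vertices: "finite (vertices t)"
  by (induction t) (auto simp: vertices_Node)

text \<open>Kept general in \<open>P\<close> because the size of a tree and the count
  \<open>occ\<close> both get their recursion from it.\<close>

lemma card_vertices_filter:
  "card {u \<in> vertices (Node ts). P u}
     = (if P [] then 1 else 0) + (\<Sum>i<length ts. card {u \<in> vertices (ts ! i). P (i # u)})"
proof -
  have eq: "{u \<in> vertices (Node ts). P u} = (if P [] then {[]} else {}) \<union>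
      (\<Union>i<length ts. (#) i ` {u \<in> vertices (ts ! i). P (i # u)})"
    by (auto simp: vertices_Node)
  have "card {u \<in> vertices (Node ts). P u} = card (if P [] then {[]::nat list} else {}) +
      card (\<Union>i<length ts. (#) i ` {u \<in> vertices (ts ! i). P (i # u)})"
    unfolding eq by (rule card_Un_disjoint) (auto simp: finite_vertices)
  also have "card (\<Union>i<length ts. (#) i ` {u \<in> vertices (ts ! i). P (i # u)})
     = (\<Sum>i<length ts. card ((#) i ` {u \<in> vertices (ts ! i). P (i # u)}))"
    by (rule card_UN_disjoint) (auto simp: finite_vertices)
  also have "\<dots> = (\<Sum>i<length ts. card {u \<in> vertices (ts ! i). P (i # u)})"
    by (simp add: card_image)
  finally show ?thesis by auto
qed

lemma sum_list_conv_sum_nth: "sum_list (map f xs) = (\<Sum>i<length xs. f (xs ! i))"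
  by (simp add: sum_list_sum_nth atLeast0LessThan)

lemma card_vertices: "card (vertices t) = tsize t"
proof (induction t)
  case (Node ts)
  have "card (vertices (Node ts)) = 1 + (\<Sum>i<length ts. card (vertices (ts ! i)))"
    using card_vertices_filter[of ts "\<lambda>_. True"] by simp
  then show ?case using Node by (simp add: sum_list_conv_sum_nth)
qed

definition occ :: "ptree \<Rightarrow> ptree \<Rightarrow> nat" where
  "occ t T = card {u \<in> vertices T. subtree T u = t}"

lemma occ_Node: "occ t (Node ts) = (if Node ts = t then 1 else 0) + sum_list (map (occ t) ts)"
  unfolding occ_def card_vertices_filter by (simp add: subtree_Cons sum_list_conv_sum_nth)

text \<open>Such a vertex is \<open>u @ v\<close> with \<open>u\<close> its k-th ancestor, and
  \<open>u\<close> ranges over the roots of the copies of \<open>t\<close>. Hence the count does not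
  depend on which vertex \<open>v\<close> of height k is marked.\<close>

lemma card_H_eq:
  assumes "v \<in> vertices t" "length v = k"
  shows "card {x \<in> vertices T. H k T x = Some (t, v)} = occ t T"
proof -
  have "{x \<in> vertices T. H k T x = Some (t, v)} = (\<lambda>u. u @ v) ` {u \<in> vertices T. subtree T u = t}"
  proof (intro equalityI subsetI)
    fix x assume x: "x \<in> {x \<in> vertices T. H k T x = Some (t, v)}"
    let ?u = "take (length x - k) x"
    have *: "x = ?u @ v" "subtree T ?u = t" using x
      by (auto simp: H_def split: if_splits)
    moreover have "?u \<in> vertices T" using x * append_in_vertices[of ?u v T] by auto
    ultimately show "x \<in> (\<lambda>u. u @ v) ` {u \<in> vertices T. subtree T u = t}" by blast
  next
    fix x assume "x \<in> (\<lambda>u. u @ v) ` {u \<in> vertices T. subtree T u = t}"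
    then show "x \<in> {x \<in> vertices T. H k T x = Some (t, v)}"
      using assms by (auto simp: append_in_vertices H_def)
  qed
  then show ?thesis by (simp add: occ_def card_image inj_on_def)
qed

text \<open>Only r = 1 is wanted in the end; deleting roots leads through all r.\<close>

definition occ_sum :: "(nat \<Rightarrow> real) \<Rightarrow> ptree \<Rightarrow> nat \<Rightarrow> nat \<Rightarrow> real" where
  "occ_sum p t n r = (\<Sum>ts\<in>forests n r. fweight p ts * real (sum_list (map (occ t) ts)))"

lemma sum_forests_hd:
  "(\<Sum>ts\<in>forests n (Suc r). fweight p ts * (if hd ts = t then 1 else 0))
     = (if tsize t \<le> n then tweight p t * forest_sum p (n - tsize t) r else 0)"
proof -
  have "(\<Sum>ts\<in>forests n (Suc r). fweight p ts * (if hd ts = t then 1 else 0))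
      = (\<Sum>ts\<in>{ts \<in> forests n (Suc r). hd ts = t}. fweight p ts)"
    by (simp add: sum.inter_filter[symmetric] finite_forests if_distrib cong: if_cong)
  also have "{ts \<in> forests n (Suc r). hd ts = t}
      = (if tsize t \<le> n then (#) t ` forests (n - tsize t) r else {})"
    by (auto simp: forests_def length_Suc_conv)
  also have "(\<Sum>ts\<in>\<dots>. fweight p ts)
      = (if tsize t \<le> n then tweight p t * forest_sum p (n - tsize t) r else 0)"
    by (auto simp: sum.reindex forest_sum_def fweight_def sum_distrib_left)
  finally show ?thesis .
qed

text \<open>Deleting the first root destroys at most one copy of \<open>t\<close>, namely the whole
  first tree; all other copies survive in the smaller forest. The second summand collects the
  forests whose first tree is \<open>t\<close>.\<close>

lemma occ_sum_Suc:
  "occ_sum p t (Suc n) (Suc r) = (\<Sum>k\<le>n. p k * occ_sum p t n (r + k))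
     + (if tsize t \<le> Suc n then tweight p t * forest_sum p (Suc n - tsize t) r else 0)"
proof -
  let ?g = "\<lambda>ts. (if hd ts = t then 1 else 0 :: real)"
  let ?h = "\<lambda>ts. sum_list (map (occ t) (children (hd ts) @ tl ts))"
  have "occ_sum p t (Suc n) (Suc r)
      = (\<Sum>ts\<in>forests (Suc n) (Suc r). fweight p ts * ?g ts + fweight p ts * real (?h ts))"
    unfolding occ_sum_def
  proof (intro sum.cong refl)
    fix ts assume "ts \<in> forests (Suc n) (Suc r)"
    then obtain T rest where "ts = T # rest" by (auto simp: forests_def length_Suc_conv)
    moreover obtain cs where "T = Node cs" by (cases T)
    ultimately have ts: "ts = Node cs # rest" by simp
    show "fweight p ts * real (sum_list (map (occ t) ts)) = fweight p ts * ?g ts + fweight p ts * real (?h ts)"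
      by (simp add: ts occ_Node algebra_simps)
  qed
  also have "\<dots> = (if tsize t \<le> Suc n then tweight p t * forest_sum p (Suc n - tsize t) r else 0)
       + (\<Sum>ts\<in>forests (Suc n) (Suc r). fweight p ts * real (?h ts))"
    by (simp only: sum.distrib sum_forests_hd)
  also have "(\<Sum>ts\<in>forests (Suc n) (Suc r). fweight p ts * real (?h ts))
      = (\<Sum>k\<le>n. p k * occ_sum p t n (r + k))"
    unfolding sum_forests_Suc occ_sum_def sum_distrib_left
  proof (intro sum.cong refl)
    fix k us assume "us \<in> forests n (r + k)"
    then have "k \<le> length us" by (simp add: forests_def)
    then show "fweight p (Node (take k us) # drop k us) * real (?h (Node (take k us) # drop k us))
        = p k * (fweight p us * real (sum_list (map (occ t) us)))"
      by (simp only: fweight_unroot) simp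
  qed
  finally show ?thesis by simp
qed

text \<open>Shrinking a marked copy of \<open>t\<close> (of size m) to a leaf leaves a forest with n
  - m + 1 vertices and a marked leaf, for which the cycle lemma predicts this formula. The proof is
  the root-deletion induction again, with \<open>forest_sum_walk\<close> accounting for copies at
  the first root.\<close>

lemma occ_sum_walk:
  "occ_sum p t n r = (if tsize t + r \<le> Suc n
     then real r * tweight p t * walk p (n - tsize t) (Suc n - tsize t - r) else 0)"
proof (induction n arbitrary: r)
  case 0
  show ?case using tsize_pos[of t]
    by (cases r) (auto simp: occ_sum_def forests_0_right forests_empty)
next
  case (Suc n)
  show ?case
  proof (cases r)
    case 0
    then show ?thesis by (auto simp: occ_sum_def forests_0_right)
  next
    case r: (Suc r')
    let ?m = "tsize t"
    show ?thesis
    proof (cases "?m + r' \<le> Suc n")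
      case False
      have "(\<Sum>k\<le>n. p k * occ_sum p t n (r' + k)) = 0"
        using False by (intro sum.neutral) (auto simp: Suc.IH)
      moreover have "forest_sum p (Suc n - ?m) r' = 0" if "?m \<le> Suc n"
        using False that by (simp add: forest_sum_def forests_empty)
      ultimately show ?thesis using False by (simp add: r occ_sum_Suc)
    next
      case True
      define N where "N = Suc n - ?m"
      have N: "Suc n = ?m + N" "r' \<le> N" using True by (auto simp: N_def)
      have m: "?m \<le> Suc n" using True by simp
      show ?thesis
      \<comment> \<open>The general argument carries the factor N. If N = 0, the only contribution
        comes from the forest that consists of \<open>t\<close> alone.\<close>
      proof (cases N)
        case 0
        have "(\<Sum>k\<le>n. p k * occ_sum p t n (r' + k)) = 0"
          using 0 N by (intro sum.neutral) (auto simp: Suc.IH)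
        moreover have "forest_sum p N r' = 1"
          using 0 N by (simp add: forest_sum_def forests_0_right fweight_def)
        ultimately have "occ_sum p t (Suc n) r = tweight p t"
          unfolding r occ_sum_Suc N_def[symmetric] using m by simp
        then show ?thesis using 0 N by (simp add: r walk_0)
      next
        case N': (Suc N')
        define j where "j = N - r'"
        have j: "N = r' + j" using N by (simp add: j_def)
        have "(\<Sum>k\<le>n. p k * occ_sum p t n (r' + k)) = (\<Sum>k\<le>j. p k * occ_sum p t n (r' + k))"
          using N j tsize_pos[of t] by (intro sum.mono_neutral_right) (auto simp: Suc.IH)
        also have "\<dots> = (\<Sum>k\<le>j. tweight p t * (p k * (real (r' + k) * walk p N' (j - k))))"
        proof (intro sum.cong refl)
          fix k assume "k \<in> {..j}"
          then have "?m + (r' + k) \<le> Suc n" "n - ?m = N'" "Suc n - ?m - (r' + k) = j - k"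
            using N j N' by auto
          then show "p k * occ_sum p t n (r' + k) = tweight p t * (p k * (real (r' + k) * walk p N' (j - k)))"
            by (simp only: Suc.IH if_True mult_ac)
        qed
        finally have 1: "real N * (\<Sum>k\<le>n. p k * occ_sum p t n (r' + k))
           = tweight p t * ((real N * real r' + real j) * walk p N j)"
          using sum_walk_shift[of N' p r' j] N' by (simp add: sum_distrib_left[symmetric])
        have 2: "real N * forest_sum p N r' = real r' * walk p N j"
          using forest_sum_walk[of r' N p] j by simp
        have "real N * occ_sum p t (Suc n) r
            = tweight p t * ((real N * real r' + real j) * walk p N j + real r' * walk p N j)"
          unfolding r occ_sum_Suc N_def[symmetric] using 1 2 m by (simp add: distrib_left mult_ac)
        \<comment> \<open>As j + r' = N, the coefficient of the walk term is N r' + N = N r.\<close>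
        also have "\<dots> = real N * (real r * tweight p t * walk p N j)"
          by (simp add: r j algebra_simps)
        finally have "occ_sum p t (Suc n) r = real r * tweight p t * walk p N j"
          using N' by (simp del: of_nat_Suc)
        moreover have "Suc (Suc n) - ?m - r = j" "?m + r \<le> Suc (Suc n)"
          using N j r by auto
        ultimately show ?thesis by (simp only: N_def if_True)
      qed
    qed
  qed
qed

subsection \<open>Local limit theorem\<close>

lemma pmf_nat_integral:
  fixes f :: "nat \<Rightarrow> 'b :: {banach, second_countable_topology}"
  assumes "summable (\<lambda>k. norm (pmf P k *\<^sub>R f k))"
  shows "integrable (measure_pmf P) f"
    and "(\<lambda>k. pmf P k *\<^sub>R f k) sums (\<integral>x. f x \<partial>measure_pmf P)"
proof -
  have *: "integrable (count_space UNIV) (\<lambda>k. pmf P k *\<^sub>R f k)"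
    using assms by (simp only: integrable_count_space_nat_iff)
  then show "integrable (measure_pmf P) f"
    unfolding measure_pmf_eq_density by (subst integrable_density) auto
  show "(\<lambda>k. pmf P k *\<^sub>R f k) sums (\<integral>x. f x \<partial>measure_pmf P)"
    unfolding measure_pmf_eq_density
    by (subst integral_density) (use sums_integral_count_space_nat[OF *] in auto)
qed

text \<open>Orthogonality of characters: for a nonzero multiple m of d the interval consists of
  whole periods, so the antiderivative agrees at both ends.\<close>

lemma has_bochner_integral_iexp_period:
  fixes d :: nat and m :: int
  assumes "0 < d" "int d dvd m"
  shows "has_bochner_integral lborel
    (\<lambda>t. indicator {-(pi / d)..pi / d} t *\<^sub>R iexp (t * of_int m)) (if m = 0 then 2 * pi / d else 0)"
proof (cases "m = 0")
  case True
  have "has_bochner_integral lborel (\<lambda>t. indicator {-(pi / d)..pi / d} t *\<^sub>R (1::complex))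
      (complex_of_real (pi / d) - complex_of_real (-(pi / d)))"
    by (rule has_bochner_integral_FTC_Icc)
       (auto intro!: derivative_eq_intros has_vector_derivative_of_real)
  then show ?thesis using True by simp
next
  case False
  obtain q where q: "m = int d * q" using assms(2) by blast
  have "pi / d * of_int m = of_int q * pi" using assms(1) by (simp add: q)
  then have eq: "iexp (pi / d * of_int m) = iexp (- (pi / d) * of_int m)"
    by (simp add: exp_eq exp_minus[symmetric])
  let ?F = "\<lambda>t. iexp (t * of_int m) / (\<i> * of_int m)"
  have "has_bochner_integral lborel (\<lambda>t. indicator {-(pi / d)..pi / d} t *\<^sub>R iexp (t * of_int m))
      (?F (pi / d) - ?F (- (pi / d)))"
  proof (rule has_bochner_integral_FTC_Icc)
    fix x :: real
    have "((\<lambda>z. exp (\<i> * (z * of_int m)) / (\<i> * of_int m)) has_field_derivative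
        exp (\<i> * (of_real x * of_int m))) (at (of_real x))"
      using False by (auto intro!: derivative_eq_intros simp: mult_ac)
    then have "((\<lambda>t. exp (\<i> * (of_real t * of_int m)) / (\<i> * of_int m)) has_vector_derivative
        exp (\<i> * (of_real x * of_int m))) (at x within {-(pi / d)..pi / d})"
      by (rule has_vector_derivative_real_field)
    then show "(?F has_vector_derivative iexp (x * of_int m)) (at x within {-(pi / d)..pi / d})"
      by simp
  qed (auto intro!: continuous_intros)
  then show ?thesis unfolding eq using False by simp
qed

text \<open>The k for which k times theta is an integer are closed under remainders, so the least
  positive one, \<open>g\<close>, divides every element of \<open>A\<close> and hence the
  gcd.\<close>

lemma Gcd_multiple_in_Ints:
  fixes \<theta> :: real and A :: "nat set"
  assumes "\<And>k. k \<in> A \<Longrightarrow> real k * \<theta> \<in> \<int>" "\<exists>k\<in>A. 0 < k"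
  shows "real (Gcd A) * \<theta> \<in> \<int>"
proof -
  define g where "g = (LEAST k. 0 < k \<and> real k * \<theta> \<in> \<int>)"
  have "\<exists>k. 0 < k \<and> real k * \<theta> \<in> \<int>" using assms by auto
  from LeastI_ex[OF this] have g: "0 < g" "real g * \<theta> \<in> \<int>" by (auto simp: g_def)
  have "g dvd k" if "k \<in> A" for k
  proof -
    have "real k = real (k div g) * real g + real (k mod g)"
      by (metis of_nat_add of_nat_mult div_mult_mod_eq)
    then have "real (k mod g) * \<theta> = real k * \<theta> - real (k div g) * (real g * \<theta>)"
      by (simp add: algebra_simps)
    also have "\<dots> \<in> \<int>" using assms(1)[OF that] g by (blast intro: Ints_diff Ints_mult Ints_of_nat)
    finally have "\<not> 0 < k mod g"
      using not_less_Least[of "k mod g" "\<lambda>k. 0 < k \<and> real k * \<theta> \<in> \<int>"] g(1)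
      by (auto simp: g_def[symmetric])
    then show ?thesis by (simp add: mod_eq_0_iff_dvd)
  qed
  then have "g dvd Gcd A" by (auto intro: Gcd_greatest)
  then obtain q where "Gcd A = g * q" by blast
  then have "real (Gcd A) * \<theta> = real q * (real g * \<theta>)" by simp
  also have "\<dots> \<in> \<int>" using g by (blast intro: Ints_mult Ints_of_nat)
  finally show ?thesis .
qed

lemma has_bochner_integral_gauss:
  assumes "0 < c"
  shows "has_bochner_integral lborel (\<lambda>x::real. exp (- c * x\<^sup>2)) (sqrt (pi / c))"
proof -
  let ?s = "1 / sqrt (2 * c)"
  have s: "0 < ?s" using assms by simp
  have "has_bochner_integral lborel (\<lambda>x. sqrt (pi / c) * normal_density 0 ?s x) (sqrt (pi / c) * 1)"
    using s by (intro has_bochner_integral_mult_right) (auto simp: has_bochner_integral_iff)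
  also have "(\<lambda>x. sqrt (pi / c) * normal_density 0 ?s x) = (\<lambda>x. exp (- c * x\<^sup>2))"
    using assms by (auto simp: normal_density_def power_divide real_sqrt_divide field_simps)
  finally show ?thesis by simp
qed

section \<open>Critical offspring laws with finite variance\<close>

locale critical_offspring =
  fixes p :: "nat \<Rightarrow> real" and d :: nat
  assumes p_nonneg: "0 \<le> p k"
    and p_sums: "p sums 1"
    and p_mean: "(\<lambda>k. real k * p k) sums 1"
    and p_square: "summable (\<lambda>k. (real k)\<^sup>2 * p k)"
    and p_0: "0 < p 0"
    and d_def: "d = Gcd {k. 0 < p k}"
begin

definition P :: "nat pmf" where "P = embed_pmf p"

lemma pmf_P [simp]: "pmf P k = p k"
  unfolding P_def
proof (rule pmf_embed_pmf)
  have "(\<integral>\<^sup>+ x. ennreal (p x) \<partial>count_space UNIV) = (\<Sum>x. ennreal (p x))"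
    by (rule nn_integral_count_space_nat)
  also have "\<dots> = ennreal 1" by (rule suminf_ennreal_eq[OF p_nonneg p_sums])
  finally show "(\<integral>\<^sup>+ x. ennreal (p x) \<partial>count_space UNIV) = 1" by simp
qed (rule p_nonneg)

text \<open>A law on {0, 1} with mean 1 is concentrated at 1, which \<open>p_0\<close>
  excludes.\<close>

lemma ex_ge_2: "\<exists>k\<ge>2. 0 < p k"
proof (rule ccontr)
  assume "\<not> ?thesis"
  then have z: "p k = 0" if "k \<ge> 2" for k using p_nonneg[of k] that by force
  have "f sums (\<Sum>k\<in>{0,1}. f k)" if "\<And>k. k \<ge> 2 \<Longrightarrow> f k = 0" for f :: "nat \<Rightarrow> real"
    by (rule sums_finite) (auto intro: that)
  from this[of p] this[of "\<lambda>k. real k * p k"] z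
  have "p sums (\<Sum>k\<in>{0,1}. p k)" "(\<lambda>k. real k * p k) sums (\<Sum>k\<in>{0,1}. real k * p k)"
    by auto
  then have "p 0 + p 1 = 1" "p 1 = 1"
    using p_sums p_mean by (auto dest: sums_unique2)
  then show False using p_0 by simp
qed

lemma p_nonzero_dvd: "p k \<noteq> 0 \<Longrightarrow> d dvd k"
  using p_nonneg[of k] by (auto simp: d_def less_le intro: Gcd_dvd)

lemma d_pos: "0 < d"
proof -
  obtain k where "k \<ge> 2" "0 < p k" using ex_ge_2 by blast
  then have "d dvd k" using p_nonzero_dvd by force
  then show ?thesis using \<open>k \<ge> 2\<close> by (auto intro: Nat.gr0I)
qed

lemma walk_sums: "(\<lambda>j. walk p n j) sums 1"
proof (induction n)
  case 0
  show ?case using sums_single[of 0 "\<lambda>_. 1::real"] by (simp add: walk_0)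
next
  case (Suc n)
  have "(\<lambda>j. \<Sum>i\<le>j. p i * walk p n (j - i)) sums ((\<Sum>k. p k) * (\<Sum>k. walk p n k))"
    using p_sums Suc p_nonneg walk_nonneg[of p, OF p_nonneg]
    by (intro Cauchy_product_sums) (auto simp: sums_iff)
  then show ?case using p_sums Suc by (simp add: walk_Suc sums_iff)
qed

lemma summable_walk_gf:
  assumes "norm (z :: complex) \<le> 1"
  shows "summable (\<lambda>j. norm (of_real (walk p n j) * z ^ j))"
proof (rule summable_comparison_test')
  show "summable (walk p n)" using walk_sums by (simp add: sums_iff)
  show "norm (norm (of_real (walk p n j) * z ^ j)) \<le> walk p n j" for j
    using walk_nonneg[of p, OF p_nonneg] assms
    by (simp add: norm_mult norm_power mult_left_le power_le_one)
qed

lemma walk_1: "walk p 1 = p"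
  by (rule ext) (simp add: walk_def)

lemma walk_gf_sums:
  assumes "norm (z :: complex) \<le> 1"
  shows "(\<lambda>j. of_real (walk p n j) * z ^ j) sums (\<Sum>k. of_real (p k) * z ^ k) ^ n"
proof (induction n)
  case 0
  have "(\<lambda>j. of_real (walk p 0 j) * z ^ j) = (\<lambda>j. if j = 0 then 1 else 0)"
    by (auto simp: walk_0)
  then show ?case using sums_single[of 0 "\<lambda>_. 1::complex"] by simp
next
  case (Suc n)
  have "(\<lambda>j. \<Sum>i\<le>j. (of_real (p i) * z ^ i) * (of_real (walk p n (j - i)) * z ^ (j - i))) sums
      ((\<Sum>k. of_real (p k) * z ^ k) * (\<Sum>k. of_real (walk p n k) * z ^ k))"
    using summable_walk_gf[OF assms, of 1] summable_walk_gf[OF assms, of n]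
    unfolding walk_1 by (intro Cauchy_product_sums)
  also have "(\<lambda>j. \<Sum>i\<le>j. (of_real (p i) * z ^ i) * (of_real (walk p n (j - i)) * z ^ (j - i)))
      = (\<lambda>j. of_real (walk p (Suc n) j) * z ^ j)"
  proof (rule ext)
    fix j
    show "(\<Sum>i\<le>j. (of_real (p i) * z ^ i) * (of_real (walk p n (j - i)) * z ^ (j - i)))
        = of_real (walk p (Suc n) j) * z ^ j"
      unfolding walk_Suc of_real_sum sum_distrib_right
      by (intro sum.cong refl) (auto simp: power_add[symmetric] mult_ac)
  qed
  finally show ?case using Suc by (simp add: sums_iff)
qed

text \<open>The variance of xi, whose mean is 1.\<close>

definition sigma2 :: real where "sigma2 = (\<Sum>k. p k * (real k - 1)\<^sup>2)"

lemma sigma2_sums: "(\<lambda>k. p k * (real k - 1)\<^sup>2) sums sigma2"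
proof -
  have "summable (\<lambda>k. (real k)\<^sup>2 * p k - 2 * (real k * p k) + p k)"
    using p_square p_mean p_sums
    by (intro summable_add summable_diff summable_mult) (auto simp: sums_iff)
  then have "summable (\<lambda>k. p k * (real k - 1)\<^sup>2)"
    by (rule back_subst[of summable]) (auto simp: algebra_simps power2_eq_square)
  then show ?thesis unfolding sigma2_def by (rule summable_sums)
qed

lemma sigma2_pos: "0 < sigma2"
  unfolding sigma2_def
  by (rule suminf_pos2[where i = 0]) (use sigma2_sums p_nonneg p_0 in \<open>auto simp: sums_iff\<close>)

lemma square_sums: "(\<lambda>k. (real k)\<^sup>2 * p k) sums (sigma2 + 1)"
proof -
  have "(\<lambda>k. p k * (real k - 1)\<^sup>2 + 2 * (real k * p k) - p k) sums (sigma2 + 2 * 1 - 1)"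
    by (intro sums_add sums_diff sums_mult sigma2_sums p_mean p_sums)
  also have "(\<lambda>k. p k * (real k - 1)\<^sup>2 + 2 * (real k * p k) - p k) = (\<lambda>k. (real k)\<^sup>2 * p k)"
    by (auto simp: algebra_simps power2_eq_square)
  finally show ?thesis by (simp add: add.commute)
qed

section \<open>Characteristic function of the centred step xi - 1\<close>

definition step_law :: "real measure" where
  "step_law = distr (measure_pmf P) borel (\<lambda>k. real k - 1)"

definition chr :: "real \<Rightarrow> complex" where "chr = char step_law"

sublocale step: real_distribution step_law
  unfolding step_law_def by (rule prob_space.real_distribution_distr) (auto intro: measure_pmf.prob_space_axioms)

lemma step_moments:
  "integrable step_law (\<lambda>x. x)" "step.expectation (\<lambda>x. x) = 0"
  "integrable step_law (\<lambda>x. x\<^sup>2)" "step.variance (\<lambda>x. x) = sigma2"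
proof -
  have 1: "(\<lambda>k. p k * (real k - 1)) sums (1 - 1)"
    using sums_diff[OF p_mean p_sums] by (simp add: algebra_simps)
  have "summable (\<lambda>k. norm (p k *\<^sub>R (real k - 1)))"
  proof (rule summable_comparison_test')
    show "summable (\<lambda>k. real k * p k + p k)"
      using p_mean p_sums by (intro summable_add) (auto simp: sums_iff)
    show "norm (norm (p k *\<^sub>R (real k - 1))) \<le> real k * p k + p k" for k
      using p_nonneg[of k] mult_left_mono[of "\<bar>real k - 1\<bar>" "real k + 1" "p k"]
      by (simp add: abs_mult) (simp add: algebra_simps)
  qed
  from pmf_nat_integral[of P, unfolded pmf_P, OF this] 1
  have A: "integrable (measure_pmf P) (\<lambda>k. real k - 1)"
    "measure_pmf.expectation P (\<lambda>k. real k - 1) = 0"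
    by (auto dest: sums_unique2)
  have "summable (\<lambda>k. norm (p k *\<^sub>R (real k - 1)\<^sup>2))"
    using sigma2_sums p_nonneg by (auto simp: sums_iff)
  from pmf_nat_integral[of P, unfolded pmf_P, OF this] sigma2_sums
  have B: "integrable (measure_pmf P) (\<lambda>k. (real k - 1)\<^sup>2)"
    "measure_pmf.expectation P (\<lambda>k. (real k - 1)\<^sup>2) = sigma2"
    by (auto dest: sums_unique2)
  show "integrable step_law (\<lambda>x. x)" "integrable step_law (\<lambda>x. x\<^sup>2)"
    using A B by (auto simp: step_law_def integrable_distr_eq)
  show *: "step.expectation (\<lambda>x. x) = 0"
    using A by (auto simp: step_law_def integral_distr)
  show "step.variance (\<lambda>x. x) = sigma2"
    unfolding * using B by (auto simp: step_law_def integral_distr)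
qed

text \<open>The error functional of the second-order expansion at 0. The minimum is dominated by 6
  x^2, so a finite second moment already makes it vanish as t tends to 0.\<close>

definition rem :: "real \<Rightarrow> real" where
  "rem t = step.expectation (\<lambda>x. min (6 * x\<^sup>2) (\<bar>t\<bar> * \<bar>x\<bar> ^ 3))"

lemma chr_expansion: "cmod (chr t - (1 - t\<^sup>2 * sigma2 / 2)) \<le> t\<^sup>2 / 6 * rem t"
  unfolding chr_def rem_def by (rule step.char_approx3) (use step_moments in auto)

lemma rem_tendsto_0: "(rem \<longlongrightarrow> 0) (at 0)"
proof (rule LIMSEQ_SEQ_conv[THEN iffD1], intro allI impI)
  fix S :: "nat \<Rightarrow> real" assume "(\<forall>n. S n \<noteq> 0) \<and> S \<longlonglongrightarrow> 0"
  then have S: "S \<longlonglongrightarrow> 0" by simp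
  have "(\<lambda>n. min (6 * x\<^sup>2) (\<bar>S n\<bar> * \<bar>x\<bar> ^ 3)) \<longlonglongrightarrow> min (6 * x\<^sup>2) (\<bar>0\<bar> * \<bar>x\<bar> ^ 3)" for x
    by (intro tendsto_intros S)
  then have "(\<lambda>n. rem (S n)) \<longlonglongrightarrow> step.expectation (\<lambda>x. 0)"
    unfolding rem_def using step_moments(3)
    by (intro integral_dominated_convergence[where w = "\<lambda>x. 6 * x\<^sup>2"]) auto
  then show "(\<lambda>n. rem (S n)) \<longlonglongrightarrow> 0" by simp
qed

lemma cmod_chr_le_1: "cmod (chr t) \<le> 1"
  unfolding chr_def by (rule step.cmod_char_le_1)

lemma chr_sums: "(\<lambda>k. of_real (p k) * iexp t ^ k) sums (chr t * iexp t)"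
proof -
  have "summable (\<lambda>k. norm (p k *\<^sub>R iexp (t * (real k - 1))))"
    using p_sums p_nonneg by (auto simp: sums_iff)
  from pmf_nat_integral(2)[of P, unfolded pmf_P, OF this]
  have "(\<lambda>k. p k *\<^sub>R iexp (t * (real k - 1))) sums chr t"
    unfolding chr_def char_def step_law_def by (subst integral_distr) auto
  then have "(\<lambda>k. (p k *\<^sub>R iexp (t * (real k - 1))) * iexp t) sums (chr t * iexp t)"
    by (rule sums_mult2)
  also have "(\<lambda>k. (p k *\<^sub>R iexp (t * (real k - 1))) * iexp t) = (\<lambda>k. of_real (p k) * iexp t ^ k)"
    by (rule ext) (simp add: scaleR_conv_of_real exp_of_nat_mult[symmetric] exp_add[symmetric] algebra_simps)
  finally show ?thesis .
qed

text \<open>If \<open>|\<chi>(t)| = 1\<close> then, as \<open>p 0 > 0\<close>, \<open>t k\<close> is a multiple of \<open>2\<pi>\<close> for all \<open>k\<close> in the support, hence also \<open>t d\<close>.\<close>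
lemma chr_less_1:
  assumes "t \<noteq> 0" "\<bar>t\<bar> \<le> pi / d"
  shows "cmod (chr t) < 1"
proof (rule ccontr)
  assume not_less: "\<not> ?thesis"
  define u where "u = chr t * iexp t"
  have u: "cmod u = 1" using not_less cmod_chr_le_1[of t] by (simp add: u_def norm_mult)
  \<comment> \<open>Equality case of the triangle inequality: after rotation by the conjugate of u
    the real parts sum to 1, as does \<open>p\<close>, and none exceeds p k; so they agree term by
    term.\<close>
  have "(\<lambda>k. Re (cnj u * (of_real (p k) * iexp t ^ k))) sums Re (cnj u * u)"
    unfolding u_def by (intro sums_Re sums_mult chr_sums)
  also have "Re (cnj u * u) = 1" using u by (metis Re_complex_of_real complex_norm_square mult.commute one_power2)
  finally have "(\<lambda>k. p k - Re (cnj u * (of_real (p k) * iexp t ^ k))) sums (1 - 1)"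
    by (intro sums_diff p_sums)
  also have "(\<lambda>k. p k - Re (cnj u * (of_real (p k) * iexp t ^ k)))
      = (\<lambda>k. p k * (1 - Re (cnj u * iexp t ^ k)))"
    by (auto simp: algebra_simps)
  finally have s: "(\<lambda>k. p k * (1 - Re (cnj u * iexp t ^ k))) sums 0" by simp
  have nrm: "cmod (cnj u * iexp t ^ k) = 1" for k using u by (simp add: norm_mult norm_power)
  have "0 \<le> p k * (1 - Re (cnj u * iexp t ^ k))" for k
    using p_nonneg complex_Re_le_cmod[of "cnj u * iexp t ^ k"] nrm[of k] by simp
  with s have *: "p k * (1 - Re (cnj u * iexp t ^ k)) = 0" for k
    using suminf_eq_zero_iff[of "\<lambda>k. p k * (1 - Re (cnj u * iexp t ^ k))"] by (auto simp: sums_iff)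
  have one: "cnj u * iexp t ^ k = 1" if "0 < p k" for k
  proof -
    have "Re (cnj u * iexp t ^ k) = 1" using *[of k] that by simp
    moreover have "Im (cnj u * iexp t ^ k) = 0"
      using nrm[of k] calculation cmod_power2[of "cnj u * iexp t ^ k"] by simp
    ultimately show ?thesis by (simp add: complex_eq_iff)
  qed
  have "cnj u = 1" using one[of 0] p_0 by simp
  have "real k * (t / (2 * pi)) \<in> \<int>" if "k \<in> {k. 0 < p k}" for k
  proof -
    have "iexp t ^ k = 1" using one[of k] that \<open>cnj u = 1\<close> by simp
    then have "exp (of_nat k * (\<i> * complex_of_real t)) = 1" by (simp only: exp_of_nat_mult)
    then obtain m :: int where "real k * t = of_int (2 * m) * pi"
      by (auto simp: exp_eq_1)
    then have "real k * (t / (2 * pi)) = of_int m" by (simp add: field_simps)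
    then show ?thesis by simp
  qed
  moreover have "\<exists>k\<in>{k. 0 < p k}. 0 < k" using ex_ge_2 by force
  ultimately have "real d * (t / (2 * pi)) \<in> \<int>"
    unfolding d_def by (rule Gcd_multiple_in_Ints)
  then obtain m :: int where m: "real d * (t / (2 * pi)) = of_int m" by (auto elim: Ints_cases)
  \<comment> \<open>The restriction to the interval of length 2 pi / d makes this integer at most
    1/2 in absolute value.\<close>
  have "\<bar>real d * (t / (2 * pi))\<bar> \<le> 1 / 2"
    using assms(2) d_pos by (simp add: abs_mult field_simps)
  then have "m = 0" unfolding m by linarith
  then show False using m d_pos assms(1) by simp
qed

text \<open>Near 0 the expansion gives the bound; away from 0 it follows from compactness and
  \<open>chr_less_1\<close>. It supplies the Gaussian domination in the local limit theorem.\<close>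

lemma chr_quadratic_bound:
  obtains c where "0 < c" "\<And>t. \<bar>t\<bar> \<le> pi / d \<Longrightarrow> cmod (chr t) \<le> 1 - c * t\<^sup>2"
proof -
  \<comment> \<open>With this threshold the error t^2/6 times \<open>rem t\<close> is at most half
    of the decrease t^2 \<open>sigma2\<close>/2. The second condition keeps the main term positive,
    so that it is its own modulus.\<close>
  have "eventually (\<lambda>t. rem t < 3 * sigma2 / 2) (at 0)"
    using rem_tendsto_0 sigma2_pos by (intro order_tendstoD(2)) auto
  moreover have "((\<lambda>t. t\<^sup>2 * sigma2 / 2) \<longlongrightarrow> 0) (at 0)"
    by (auto intro!: tendsto_eq_intros)
  then have "eventually (\<lambda>t. t\<^sup>2 * sigma2 / 2 < 1) (at 0)"
    by (intro order_tendstoD(2)) auto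
  ultimately have "eventually (\<lambda>t. rem t < 3 * sigma2 / 2 \<and> t\<^sup>2 * sigma2 / 2 < 1) (at 0)"
    by eventually_elim auto
  then obtain \<delta> where \<delta>: "\<delta> > 0" "\<And>t. t \<noteq> 0 \<Longrightarrow> \<bar>t\<bar> < \<delta> \<Longrightarrow> rem t < 3 * sigma2 / 2 \<and> t\<^sup>2 * sigma2 / 2 < 1"
    by (auto simp: eventually_at dist_real_def)
  have near: "cmod (chr t) \<le> 1 - sigma2 / 4 * t\<^sup>2" if "\<bar>t\<bar> < \<delta>" for t
  proof (cases "t = 0")
    case True
    then show ?thesis using cmod_chr_le_1[of t] by simp
  next
    case False
    then have r: "rem t < 3 * sigma2 / 2" "t\<^sup>2 * sigma2 / 2 < 1" using \<delta> that by auto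
    let ?x = "1 - t\<^sup>2 * sigma2 / 2"
    have "cmod (chr t) \<le> cmod (of_real ?x) + cmod (chr t - of_real ?x)"
      by (metis norm_triangle_sub)
    moreover have "cmod (of_real ?x) = ?x" using r(2) by (simp only: norm_of_real)
    moreover have "cmod (chr t - of_real ?x) \<le> t\<^sup>2 / 6 * rem t"
      using chr_expansion[of t] by simp
    moreover have "t\<^sup>2 / 6 * rem t \<le> t\<^sup>2 / 6 * (3 * sigma2 / 2)"
      using r(1) by (intro mult_left_mono) auto
    ultimately have "cmod (chr t) \<le> ?x + t\<^sup>2 / 6 * (3 * sigma2 / 2)" by linarith
    then show ?thesis by (simp add: algebra_simps)
  qed
  let ?K = "{-(pi / d)..pi / d} - {-\<delta><..<\<delta>}"
  have K: "compact ?K" by (intro compact_diff) auto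
  have "\<exists>M<1. \<forall>t\<in>?K. cmod (chr t) \<le> M"
  proof (cases "?K = {}")
    case True
    then show ?thesis by (auto intro: exI[of _ 0])
  next
    case False
    have "continuous_on ?K (\<lambda>t. cmod (chr t))"
      unfolding chr_def
      by (intro continuous_on_norm continuous_at_imp_continuous_on ballI step.isCont_char)
    from continuous_attains_sup[OF K False this] obtain s where
      s: "s \<in> ?K" "\<And>t. t \<in> ?K \<Longrightarrow> cmod (chr t) \<le> cmod (chr s)" by blast
    have "cmod (chr s) < 1" using s(1) \<delta>(1) by (intro chr_less_1) (auto simp: abs_le_iff)
    then show ?thesis using s(2) by blast
  qed
  then obtain M where M: "M < 1" "\<And>t. t \<in> ?K \<Longrightarrow> cmod (chr t) \<le> M" by blast
  define b where "b = pi / d"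
  have b: "b > 0" using d_pos by (simp add: b_def)
  \<comment> \<open>The second entry makes c t^2 at most 1 - M on the whole interval.\<close>
  define c where "c = min (sigma2 / 4) ((1 - M) / b\<^sup>2)"
  have "cmod (chr t) \<le> 1 - c * t\<^sup>2" if t: "\<bar>t\<bar> \<le> pi / d" for t
  proof (cases "\<bar>t\<bar> < \<delta>")
    case True
    have "c \<le> sigma2 / 4" unfolding c_def by (rule min.cobounded1)
    then have "c * t\<^sup>2 \<le> sigma2 / 4 * t\<^sup>2" by (rule mult_right_mono) simp
    then show ?thesis using near[OF True] by simp
  next
    case False
    then have "cmod (chr t) \<le> M" using t by (intro M) auto
    moreover have "c * t\<^sup>2 \<le> (1 - M) / b\<^sup>2 * b\<^sup>2"
    proof (intro mult_mono)
      show "t\<^sup>2 \<le> b\<^sup>2" using t power_mono[of "\<bar>t\<bar>" b 2] by (simp add: b_def)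
    qed (use M in \<open>auto simp: c_def\<close>)
    ultimately show ?thesis using b by simp
  qed
  moreover have "0 < c" using sigma2_pos M b by (simp add: c_def)
  ultimately show ?thesis using that by blast
qed

section \<open>Fourier inversion and the Gaussian limit\<close>

definition fourier :: "nat \<Rightarrow> nat \<Rightarrow> real \<Rightarrow> complex" where
  "fourier a n t = indicator {-(pi / d)..pi / d} t *\<^sub>R (chr t ^ n * iexp (a * t))"

text \<open>The n-th power of the characteristic function expands into the law of S_n - n;
  integrated term by term, only j = n - a survives. Indices j that d does not divide have weight
  zero, so integrating over length 2 pi / d is enough.\<close>

lemma integral_fourier:
  assumes "a \<le> n" "d dvd n - a"
  shows "(\<integral>t. fourier a n t \<partial>lborel) = of_real (2 * pi / d * walk p n (n - a))"
proof -
  define m where "m = n - a"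
  define f where "f = (\<lambda>j t. indicator {-(pi / d)..pi / d} t *\<^sub>R (of_real (walk p n j) * iexp (t * of_int (int j - int m))))"
  have eq: "fourier a n t = (\<Sum>j. f j t)" for t
  proof -
    have "(\<lambda>j. of_real (walk p n j) * iexp t ^ j) sums (chr t * iexp t) ^ n"
      using walk_gf_sums[of "iexp t" n] chr_sums[of t] by (simp add: sums_iff)
    then have "(\<lambda>j. (of_real (walk p n j) * iexp t ^ j) * iexp (- (t * real m))) sums
        ((chr t * iexp t) ^ n * iexp (- (t * real m)))" by (rule sums_mult2)
    also have "(chr t * iexp t) ^ n * iexp (- (t * real m)) = chr t ^ n * iexp (a * t)"
      using assms(1)
      by (simp add: power_mult_distrib exp_of_nat_mult[symmetric] exp_add[symmetric] m_def
            of_nat_diff algebra_simps)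
    also have "(\<lambda>j. (of_real (walk p n j) * iexp t ^ j) * iexp (- (t * real m)))
        = (\<lambda>j. of_real (walk p n j) * iexp (t * of_int (int j - int m)))"
      by (auto simp: exp_of_nat_mult[symmetric] exp_add[symmetric] algebra_simps)
    finally have "(\<lambda>j. f j t) sums fourier a n t"
      unfolding fourier_def f_def by (rule sums_scaleR_right)
    then show ?thesis by (simp add: sums_iff)
  qed
  have hb: "has_bochner_integral lborel (f j) (if j = m then of_real (2 * pi / d * walk p n j) else 0)" for j
  proof (cases "walk p n j = 0")
    case True
    then show ?thesis by (auto simp: f_def has_bochner_integral_zero)
  next
    case False
    have "d dvd j" using p_nonzero_dvd False by (rule walk_nonzero_dvd)
    then have "int d dvd int j - int m" using assms(2) by (simp add: m_def)
    from has_bochner_integral_mult_right[OF has_bochner_integral_iexp_period[OF d_pos this], of "of_real (walk p n j)"]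
    show ?thesis by (auto simp: f_def mult_ac)
  qed
  have bound: "norm (f j t) \<le> walk p n j * indicator {-(pi / d)..pi / d} t" for j t
    using walk_nonneg[of p, OF p_nonneg] by (auto simp: f_def norm_mult split: split_indicator)
  have int: "integrable lborel (f j)" for j
    using hb[of j] unfolding has_bochner_integral_iff by blast
  have "(\<lambda>j. integral\<^sup>L lborel (f j)) sums (\<integral>t. (\<Sum>j. f j t) \<partial>lborel)"
  proof (rule sums_integral)
    show "integrable lborel (f j)" for j by (rule int)
    show "AE t in lborel. summable (\<lambda>j. norm (f j t))"
    proof (rule AE_I2, rule summable_comparison_test')
      fix t :: real
      show "summable (\<lambda>j. walk p n j * indicator {-(pi / d)..pi / d} t)"
        using walk_sums by (intro summable_mult2) (auto simp: sums_iff)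
      show "norm (norm (f j t)) \<le> walk p n j * indicator {-(pi / d)..pi / d} t" for j
        using bound[of j t] by simp
    qed
    have le: "(\<integral>t. norm (f j t) \<partial>lborel) \<le> walk p n j * (2 * pi / d)" for j
    proof -
      have "(\<integral>t. norm (f j t) \<partial>lborel) \<le> (\<integral>t. walk p n j * indicator {-(pi / d)..pi / d} t \<partial>lborel)"
        by (rule integral_mono[OF integrable_norm[OF int] _ bound]) simp
      then show ?thesis using d_pos by simp
    qed
    have s: "summable (\<lambda>j. walk p n j * (2 * pi / d))"
      using walk_sums by (intro summable_mult2) (auto simp: sums_iff)
    show "summable (\<lambda>j. \<integral>t. norm (f j t) \<partial>lborel)"
      by (rule summable_comparison_test'[OF s]) (use le in \<open>simp add: integral_nonneg\<close>)
  qed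
  also have "(\<lambda>j. integral\<^sup>L lborel (f j)) = (\<lambda>j. if j = m then of_real (2 * pi / d * walk p n j) else 0)"
    by (rule ext) (rule has_bochner_integral_integral_eq[OF hb])
  finally have "(\<integral>t. (\<Sum>j. f j t) \<partial>lborel) = of_real (2 * pi / d * walk p n m)"
    using sums_single[of m "\<lambda>j. complex_of_real (2 * pi / d * walk p n j)"] by (auto dest: sums_unique2)
  then show ?thesis unfolding eq m_def .
qed

text \<open>The n-th powers of two numbers of modulus at most 1 differ by at most n times their
  distance. By the expansion, the distance to (1 - \<open>sigma2\<close> t^2 / (2n))^n is thus at
  most t^2/6 times \<open>rem (t / sqrt n)\<close>, which vanishes.\<close>

lemma chr_scaled_tendsto:
  "(\<lambda>n. chr (t / sqrt (real n)) ^ n) \<longlonglongrightarrow> of_real (exp (- (sigma2 / 2) * t\<^sup>2))"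
proof -
  let ?t = "\<lambda>n. t / sqrt (real n)"
  have t0: "?t \<longlonglongrightarrow> 0"
    by (intro tendsto_divide_0[OF tendsto_const] filterlim_at_top_imp_at_infinity
          filterlim_compose[OF sqrt_at_top filterlim_real_sequentially])
  let ?y = "\<lambda>n. 1 + (- (sigma2 / 2) * t\<^sup>2) / real n"
  have bound: "eventually (\<lambda>n. cmod (chr (?t n) ^ n - of_real (?y n ^ n)) \<le> t\<^sup>2 / 6 * rem (?t n)) sequentially"
  proof -
    have "(\<lambda>n. ?y n) \<longlonglongrightarrow> 1 + 0"
      by (intro tendsto_add tendsto_const tendsto_divide_0[OF tendsto_const]
            filterlim_at_top_imp_at_infinity filterlim_real_sequentially)
    then have "eventually (\<lambda>n. ?y n > 0) sequentially" by (intro order_tendstoD(1)) auto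
    with eventually_gt_at_top[of 0] show ?thesis
    proof eventually_elim
      case (elim n)
      have sq: "(?t n)\<^sup>2 = t\<^sup>2 / n" using elim by (simp add: power_divide)
      have y: "?y n = 1 - (?t n)\<^sup>2 * sigma2 / 2" unfolding sq by (simp add: field_simps)
      have "?y n \<le> 1" using sigma2_pos by (simp add: y)
      with elim have "\<bar>?y n\<bar> \<le> 1" by (simp only: abs_of_pos)
      then have "cmod (of_real (?y n)) \<le> 1" by (simp only: norm_of_real)
      from norm_power_diff[OF cmod_chr_le_1 this, of "?t n" n]
      have "cmod (chr (?t n) ^ n - of_real (?y n ^ n)) \<le> real n * cmod (chr (?t n) - of_real (?y n))"
        by (simp only: of_real_power)
      also have "cmod (chr (?t n) - of_real (?y n)) \<le> (?t n)\<^sup>2 / 6 * rem (?t n)"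
        using chr_expansion[of "?t n"] unfolding y by simp
      finally show ?case using elim unfolding sq by (simp add: mult_left_mono)
    qed
  qed
  \<comment> \<open>The limit of \<open>rem\<close> at 0 ignores the point 0 itself, but for t = 0
    the argument is constantly 0; hence continuity is established.\<close>
  have "rem 0 = 0" by (simp add: rem_def)
  then have "isCont rem 0" using rem_tendsto_0 by (simp add: isCont_def)
  then have "(\<lambda>n. rem (?t n)) \<longlonglongrightarrow> 0"
    using isCont_tendsto_compose[OF _ t0, of rem] \<open>rem 0 = 0\<close> by simp
  then have "(\<lambda>n. t\<^sup>2 / 6 * rem (?t n)) \<longlonglongrightarrow> 0" by (rule tendsto_mult_right_zero)
  from Lim_null_comparison[OF bound this]
  have d0: "(\<lambda>n. chr (?t n) ^ n - of_real (?y n ^ n)) \<longlonglongrightarrow> 0" .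
  have "(\<lambda>n. complex_of_real (?y n ^ n)) \<longlonglongrightarrow> of_real (exp (- (sigma2 / 2) * t\<^sup>2))"
    by (intro tendsto_of_real tendsto_exp_limit_sequentially)
  from Lim_transform[OF this d0] show ?thesis .
qed

text \<open>By \<open>chr_quadratic_bound\<close> the integrand is at most exp(-c u^2) in modulus,
  so pointwise convergence to the Gaussian passes to the integrals.\<close>

lemma fourier_scaled_tendsto:
  "(\<lambda>n. \<integral>u. fourier a n (u / sqrt (real n)) \<partial>lborel) \<longlonglongrightarrow> of_real (sqrt (pi / (sigma2 / 2)))"
proof -
  obtain c where c: "0 < c" "\<And>t. \<bar>t\<bar> \<le> pi / d \<Longrightarrow> cmod (chr t) \<le> 1 - c * t\<^sup>2"
    by (rule chr_quadratic_bound) auto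
  \<comment> \<open>The shift avoids n = 0, where u / sqrt 0 = 0 would make the integrand the
    constant 1, which is not dominated.\<close>
  let ?s = "\<lambda>n. sqrt (real (Suc n))"
  have "(\<lambda>n. \<integral>u. fourier a (Suc n) (u / ?s n) \<partial>lborel)
      \<longlonglongrightarrow> (\<integral>u. complex_of_real (exp (- (sigma2 / 2) * u\<^sup>2)) \<partial>lborel)"
  proof (rule integral_dominated_convergence[where w = "\<lambda>u. exp (- c * u\<^sup>2)"])
    show "integrable lborel (\<lambda>u::real. exp (- c * u\<^sup>2))"
      using has_bochner_integral_gauss[OF c(1)] by (simp add: has_bochner_integral_iff)
    have [measurable]: "chr \<in> borel_measurable borel" unfolding chr_def by (rule step.char_measurable)
    show "(\<lambda>u. fourier a (Suc n) (u / ?s n)) \<in> borel_measurable lborel" for n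
      unfolding fourier_def by measurable
    show "AE u in lborel. (\<lambda>n. fourier a (Suc n) (u / ?s n)) \<longlonglongrightarrow> of_real (exp (- (sigma2 / 2) * u\<^sup>2))"
    proof (rule AE_I2)
      fix u :: real
      have u0: "(\<lambda>n. u / sqrt (real n)) \<longlonglongrightarrow> 0"
        by (intro tendsto_divide_0[OF tendsto_const] filterlim_at_top_imp_at_infinity
              filterlim_compose[OF sqrt_at_top filterlim_real_sequentially])
      have "(\<lambda>n. chr (u / sqrt (real n)) ^ n * iexp (a * (u / sqrt (real n))))
          \<longlonglongrightarrow> of_real (exp (- (sigma2 / 2) * u\<^sup>2)) * iexp (real a * 0)"
        by (intro tendsto_mult chr_scaled_tendsto tendsto_exp tendsto_of_real tendsto_const u0)
      moreover have "eventually (\<lambda>n. chr (u / sqrt (real n)) ^ n * iexp (a * (u / sqrt (real n)))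
          = fourier a n (u / sqrt (real n))) sequentially"
      proof -
        have "0 < pi / d" using d_pos by simp
        then have "eventually (\<lambda>n. u / sqrt (real n) < pi / d) sequentially"
          "eventually (\<lambda>n. - (pi / d) < u / sqrt (real n)) sequentially"
          by (intro order_tendstoD[OF u0]; simp)+
        then show ?thesis by eventually_elim (auto simp: fourier_def)
      qed
      ultimately have "(\<lambda>n. fourier a n (u / sqrt (real n))) \<longlonglongrightarrow> of_real (exp (- (sigma2 / 2) * u\<^sup>2))"
        by (auto intro: Lim_transform_eventually)
      then show "(\<lambda>n. fourier a (Suc n) (u / ?s n)) \<longlonglongrightarrow> of_real (exp (- (sigma2 / 2) * u\<^sup>2))"
        by (rule LIMSEQ_Suc)
    qed
    show "AE u in lborel. norm (fourier a (Suc n) (u / ?s n)) \<le> exp (- c * u\<^sup>2)" for n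
    proof (rule AE_I2)
      fix u :: real
      let ?t = "u / ?s n"
      show "norm (fourier a (Suc n) ?t) \<le> exp (- c * u\<^sup>2)"
      proof (cases "\<bar>?t\<bar> \<le> pi / d")
        case True
        have "norm (fourier a (Suc n) ?t) \<le> cmod (chr ?t) ^ Suc n"
          by (auto simp: fourier_def norm_mult norm_power split: split_indicator)
        also have "\<dots> \<le> exp (- (c * ?t\<^sup>2)) ^ Suc n"
          using c(2)[OF True] exp_ge_add_one_self[of "- (c * ?t\<^sup>2)"] by (intro power_mono) auto
        also have "\<dots> = exp (real (Suc n) * (- (c * ?t\<^sup>2)))" by (rule exp_of_nat_mult[symmetric])
        also have "real (Suc n) * (- (c * ?t\<^sup>2)) = - c * u\<^sup>2"
          by (simp add: power_divide del: of_nat_Suc)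
        finally show ?thesis .
      next
        case False
        then have "fourier a (Suc n) ?t = 0" by (auto simp: fourier_def split: split_indicator)
        then show ?thesis by simp
      qed
    qed
  qed simp
  moreover have "(\<integral>u. complex_of_real (exp (- (sigma2 / 2) * u\<^sup>2)) \<partial>lborel) = of_real (sqrt (pi / (sigma2 / 2)))"
    using has_bochner_integral_gauss[of "sigma2 / 2"] sigma2_pos unfolding integral_complex_of_real
    by (auto simp: has_bochner_integral_iff)
  ultimately have "(\<lambda>n. \<integral>u. fourier a (Suc n) (u / ?s n) \<partial>lborel) \<longlonglongrightarrow> of_real (sqrt (pi / (sigma2 / 2)))"
    by (simp only:)
  then show ?thesis by (rule LIMSEQ_imp_Suc)
qed

text \<open>The centred Gaussian density of variance \<open>sigma2\<close> at 0, times the lattice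
  spacing d.\<close>

definition llt_const :: real where "llt_const = real d / sqrt (2 * pi * sigma2)"

lemma llt_const_pos: "0 < llt_const"
  using d_pos sigma2_pos by (simp add: llt_const_def)

text \<open>Substituting t = u / sqrt n in the inversion integral produces the factor 1 / sqrt n. A
  fixed offset a suffices: the law of the fringe tree has a = 0 in its numerator and a = 1 in its
  denominator.\<close>

theorem local_limit:
  assumes "0 < \<epsilon>"
  obtains N where "\<And>n. n \<ge> N \<Longrightarrow> a \<le> n \<Longrightarrow> d dvd n - a \<Longrightarrow> \<bar>sqrt n * walk p n (n - a) - llt_const\<bar> < \<epsilon>"
proof -
  let ?b = "2 * pi / real d"
  have b: "?b > 0" using d_pos by simp
  from fourier_scaled_tendsto[of a] b \<open>0 < \<epsilon>\<close> obtain N where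
    N: "\<And>n. n \<ge> N \<Longrightarrow> norm ((\<integral>u. fourier a n (u / sqrt (real n)) \<partial>lborel) - of_real (sqrt (pi / (sigma2 / 2)))) < ?b * \<epsilon>"
    unfolding LIMSEQ_iff by (meson mult_pos_pos)
  show thesis
  proof (rule that[of "max N 1"])
    fix n assume n: "n \<ge> max N 1" "a \<le> n" "d dvd n - a"
    have "of_real (?b * walk p n (n - a)) = (\<integral>t. fourier a n t \<partial>lborel)"
      by (rule integral_fourier[OF n(2,3), symmetric])
    also have "\<dots> = (1 / sqrt n) *\<^sub>R (\<integral>u. fourier a n (u / sqrt n) \<partial>lborel)"
      using n(1) lborel_integral_real_affine[of "1 / sqrt n" "fourier a n" 0] by simp
    finally have "(\<integral>u. fourier a n (u / sqrt n) \<partial>lborel) = sqrt n *\<^sub>R of_real (?b * walk p n (n - a))"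
      using n(1) by simp
    then have eq: "(\<integral>u. fourier a n (u / sqrt n) \<partial>lborel) = of_real (?b * (sqrt n * walk p n (n - a)))"
      by (simp add: scaleR_conv_of_real)
    have c: "sqrt (pi / (sigma2 / 2)) = ?b * llt_const"
    proof (rule power2_eq_imp_eq)
      show "(sqrt (pi / (sigma2 / 2)))\<^sup>2 = (?b * llt_const)\<^sup>2"
        using sigma2_pos d_pos
        by (simp add: llt_const_def power_mult_distrib power_divide) (simp add: field_simps power2_eq_square)
    qed (use sigma2_pos b llt_const_pos in auto)
    have "norm (of_real (?b * (sqrt n * walk p n (n - a))) - complex_of_real (?b * llt_const)) < ?b * \<epsilon>"
      using N[of n] n(1) unfolding eq c by simp
    then have "\<bar>?b * (sqrt n * walk p n (n - a) - llt_const)\<bar> < ?b * \<epsilon>"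
      by (simp only: of_real_diff[symmetric] norm_of_real right_diff_distrib real_norm_def)
    then show "\<bar>sqrt n * walk p n (n - a) - llt_const\<bar> < \<epsilon>"
      using b by (simp only: abs_mult abs_of_pos mult_less_cancel_left_pos)
  qed
qed

end

subsection \<open>Galton--Watson trees and the size of the pointed tree\<close>

lemma nn_integral_prod_list_length:
  fixes f :: "'a \<Rightarrow> ennreal"
  shows "(\<integral>\<^sup>+xs. prod_list (map f xs) * indicator {xs. length xs = n} xs \<partial>count_space UNIV)
    = (\<integral>\<^sup>+x. f x \<partial>count_space UNIV) ^ n"
proof (induction n)
  case 0
  have "(\<integral>\<^sup>+xs. prod_list (map f xs) * indicator {xs. length xs = 0} xs \<partial>count_space UNIV)
      = (\<integral>\<^sup>+xs. indicator {[]} xs \<partial>count_space (UNIV :: 'a list set))"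
    by (intro nn_integral_cong) (auto split: split_indicator)
  then show ?case by simp
next
  case (Suc n)
  let ?g = "\<lambda>n xs. prod_list (map f xs) * indicator {xs. length xs = n} xs"
  have bij: "bij_betw (\<lambda>(x, xs). x # xs) UNIV (UNIV - {[] :: 'a list})"
    by (rule bij_betwI[where g = "\<lambda>xs. (hd xs, tl xs)"]) auto
  have "(\<integral>\<^sup>+xs. ?g (Suc n) xs \<partial>count_space UNIV)
      = (\<integral>\<^sup>+xs. ?g (Suc n) xs * indicator (UNIV - {[]}) xs \<partial>count_space UNIV)"
    by (intro nn_integral_cong) (auto split: split_indicator)
  also have "\<dots> = (\<integral>\<^sup>+xs. ?g (Suc n) xs \<partial>count_space (UNIV - {[]}))"
    by (subst nn_integral_count_space_indicator) auto
  also have "\<dots> = (\<integral>\<^sup>+z. ?g (Suc n) ((\<lambda>(x, xs). x # xs) z) \<partial>count_space UNIV)"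
    by (rule nn_integral_bij_count_space[OF bij, symmetric])
  also have "\<dots> = (\<integral>\<^sup>+x. \<integral>\<^sup>+xs. ?g (Suc n) (x # xs) \<partial>count_space UNIV \<partial>count_space UNIV)"
    by (subst nn_integral_fst_count_space[symmetric]) simp
  also have "\<dots> = (\<integral>\<^sup>+x. \<integral>\<^sup>+xs. f x * ?g n xs \<partial>count_space UNIV \<partial>count_space UNIV)"
    by (intro nn_integral_cong) (auto simp: mult.assoc split: split_indicator)
  also have "\<dots> = (\<integral>\<^sup>+x. f x * (\<integral>\<^sup>+y. f y \<partial>count_space UNIV) ^ n \<partial>count_space UNIV)"
    using Suc by (simp add: nn_integral_cmult)
  also have "\<dots> = (\<integral>\<^sup>+y. f y \<partial>count_space UNIV) ^ Suc n"
    by (simp add: nn_integral_multc)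
  finally show ?case .
qed

text \<open>Lists are grouped by length, and the product factorises over the entries. Applied to the
  children of a root, it gives the recursion for tree weights.\<close>

lemma nn_integral_list_weight:
  fixes f :: "'a \<Rightarrow> ennreal" and q :: "nat \<Rightarrow> ennreal"
  shows "(\<integral>\<^sup>+xs. q (length xs) * prod_list (map f xs) \<partial>count_space UNIV)
    = (\<Sum>n. q n * (\<integral>\<^sup>+x. f x \<partial>count_space UNIV) ^ n)"
proof -
  let ?h = "\<lambda>n xs. q n * (prod_list (map f xs) * indicator {xs. length xs = n} xs)"
  have "q (length xs) * prod_list (map f xs) = (\<Sum>n. ?h n xs)" for xs
  proof -
    have "(\<Sum>n. ?h n xs) = (\<Sum>n\<in>{length xs}. ?h n xs)"
      by (rule suminf_finite) auto
    then show ?thesis by simp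
  qed
  then have "(\<integral>\<^sup>+xs. q (length xs) * prod_list (map f xs) \<partial>count_space UNIV)
      = (\<integral>\<^sup>+xs. (\<Sum>n. ?h n xs) \<partial>count_space UNIV)" by simp
  also have "\<dots> = (\<Sum>n. \<integral>\<^sup>+xs. ?h n xs \<partial>count_space UNIV)"
    by (rule nn_integral_suminf) simp
  also have "\<dots> = (\<Sum>n. q n * (\<integral>\<^sup>+x. f x \<partial>count_space UNIV) ^ n)"
    by (simp add: nn_integral_cmult nn_integral_prod_list_length)
  finally show ?thesis .
qed

lemma nn_integral_count_space_ptree:
  "(\<integral>\<^sup>+t. f t \<partial>count_space UNIV) = (\<integral>\<^sup>+ts. f (Node ts) \<partial>count_space UNIV)"
proof (rule nn_integral_bij_count_space[symmetric])
  show "bij_betw Node UNIV UNIV"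
    by (rule bij_betwI[where g = children]) (auto, metis children.simps ptree.exhaust)
qed

lemma prod_list_map_nonneg:
  fixes f :: "'a \<Rightarrow> real"
  shows "(\<And>x. x \<in> set xs \<Longrightarrow> 0 \<le> f x) \<Longrightarrow> 0 \<le> prod_list (map f xs)"
  by (induction xs) auto

lemma tweight_nonneg: "(\<And>k. 0 \<le> p k) \<Longrightarrow> 0 \<le> tweight p t"
  by (induction t) (auto intro!: mult_nonneg_nonneg prod_list_map_nonneg)

lemma ennreal_prod_list:
  "(\<And>x. x \<in> set xs \<Longrightarrow> 0 \<le> f x) \<Longrightarrow> ennreal (prod_list (map f xs)) = prod_list (map (\<lambda>x. ennreal (f x)) xs)"
  by (induction xs) (auto simp: ennreal_mult prod_list_map_nonneg)

lemma ennreal_tweight_Node: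
  assumes "\<And>k. 0 \<le> p k"
  shows "ennreal (tweight p (Node ts)) = ennreal (p (length ts)) * prod_list (map (\<lambda>t. ennreal (tweight p t)) ts)"
  using assms by (simp add: ennreal_mult prod_list_map_nonneg tweight_nonneg ennreal_prod_list)

text \<open>For the weights s p(k) this is the generating function f(s) of the total progeny.
  Extended values leave open, at first, whether the mass is finite.\<close>

definition total_mass :: "(nat \<Rightarrow> real) \<Rightarrow> ennreal" where
  "total_mass p = (\<integral>\<^sup>+t. ennreal (tweight p t) \<partial>count_space UNIV)"

lemma total_mass_fixpoint:
  assumes "\<And>k. 0 \<le> p k"
  shows "total_mass p = (\<Sum>k. ennreal (p k) * total_mass p ^ k)"
  unfolding total_mass_def
  by (subst nn_integral_count_space_ptree, subst ennreal_tweight_Node[OF assms]) (rule nn_integral_list_weight)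

lemma prod_list_mono_ennreal:
  fixes f g :: "'a \<Rightarrow> ennreal"
  shows "(\<And>x. x \<in> set xs \<Longrightarrow> f x \<le> g x) \<Longrightarrow> prod_list (map f xs) \<le> prod_list (map g xs)"
  by (induction xs) (auto intro!: mult_mono)

text \<open>Truncating at tree size \<open>n\<close> makes the masses comparable by induction on \<open>n\<close>.\<close>
lemma total_mass_le_1:
  assumes "\<And>k. 0 \<le> p k" "(\<Sum>k. ennreal (p k)) \<le> 1"
  shows "total_mass p \<le> 1"
proof -
  define g where "g n t = ennreal (tweight p t) * indicator {t. tsize t \<le> n} t" for n t
  have "(\<integral>\<^sup>+t. g n t \<partial>count_space UNIV) \<le> 1" for n
  proof (induction n)
    case 0
    have "g 0 t = 0" for t using tsize_pos[of t] by (simp add: g_def)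
    then show ?case by simp
  next
    case (Suc n)
    have le: "g (Suc n) (Node ts) \<le> ennreal (p (length ts)) * prod_list (map (g n) ts)" for ts
    proof (cases "tsize (Node ts) \<le> Suc n")
      case True
      have "prod_list (map (\<lambda>t. ennreal (tweight p t)) ts) \<le> prod_list (map (g n) ts)"
      proof (rule prod_list_mono_ennreal)
        fix t assume "t \<in> set ts"
        then have "tsize t \<le> sum_list (map tsize ts)" by (intro member_le_sum_list) auto
        then have "tsize t \<le> n" using True by simp
        then show "ennreal (tweight p t) \<le> g n t" by (simp add: g_def)
      qed
      then show ?thesis using True
        by (simp add: g_def ennreal_tweight_Node[OF assms(1)] mult_left_mono del: tsize.simps tweight.simps)
    qed (simp add: g_def del: tsize.simps tweight.simps)
    have "(\<integral>\<^sup>+t. g (Suc n) t \<partial>count_space UNIV) = (\<integral>\<^sup>+ts. g (Suc n) (Node ts) \<partial>count_space UNIV)"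
      by (rule nn_integral_count_space_ptree)
    also have "\<dots> \<le> (\<integral>\<^sup>+ts. ennreal (p (length ts)) * prod_list (map (g n) ts) \<partial>count_space UNIV)"
      by (intro nn_integral_mono le)
    also have "\<dots> = (\<Sum>k. ennreal (p k) * (\<integral>\<^sup>+t. g n t \<partial>count_space UNIV) ^ k)"
      by (rule nn_integral_list_weight)
    also have "\<dots> \<le> (\<Sum>k. ennreal (p k))"
    proof (intro suminf_le)
      show "ennreal (p k) * (\<integral>\<^sup>+t. g n t \<partial>count_space UNIV) ^ k \<le> ennreal (p k)" for k
        using mult_left_mono[OF power_le_one[OF _ Suc, of k], of "ennreal (p k)"] by simp
    qed auto
    finally show ?case using assms(2) by (rule order_trans)
  qed
  moreover have "total_mass p = (SUP n. \<integral>\<^sup>+t. g n t \<partial>count_space UNIV)"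
  proof -
    have "incseq g" by (auto simp: incseq_def le_fun_def g_def intro!: mult_left_mono split: split_indicator)
    have sup: "(SUP n. g n t) = ennreal (tweight p t)" for t
    proof (rule antisym)
      show "(SUP n. g n t) \<le> ennreal (tweight p t)"
        by (rule SUP_least) (auto simp: g_def split: split_indicator)
      show "ennreal (tweight p t) \<le> (SUP n. g n t)"
        by (rule SUP_upper2[of "tsize t"]) (auto simp: g_def)
    qed
    show ?thesis unfolding total_mass_def sup[symmetric]
      by (rule nn_integral_monotone_convergence_SUP[OF \<open>incseq g\<close>]) simp
  qed
  ultimately show ?thesis by (simp add: SUP_least)
qed

text \<open>Each vertex carries exactly one factor of \<open>p\<close>, so a factor s in front of
  \<open>p\<close> marks the number of vertices.\<close>

lemma tweight_scale: "tweight (\<lambda>k. s * p k) t = s ^ tsize t * tweight p t"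
proof (induction t)
  case (Node ts)
  have "prod_list (map (tweight (\<lambda>k. s * p k)) ts) = s ^ sum_list (map tsize ts) * prod_list (map (tweight p) ts)"
    using Node by (induction ts) (auto simp: power_add mult_ac)
  then show ?case by (simp add: mult_ac)
qed

section \<open>Integrals over lists of independent trees; Bernoulli inequalities\<close>

lemma nn_integral_pmf_single:
  assumes "\<And>x. x \<in> set_pmf M \<Longrightarrow> x \<noteq> a \<Longrightarrow> f x = 0"
  shows "(\<integral>\<^sup>+x. f x \<partial>measure_pmf M) = ennreal (pmf M a) * f a"
proof -
  have "(\<integral>\<^sup>+x. f x \<partial>measure_pmf M) = (\<integral>\<^sup>+x. f a * indicator {a} x \<partial>measure_pmf M)"
    by (intro nn_integral_cong_AE) (auto simp: AE_measure_pmf_iff assms split: split_indicator)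
  then show ?thesis
    by (simp add: nn_integral_cmult emeasure_pmf_single mult.commute)
qed

lemma nn_integral_replicate_prod:
  "(\<integral>\<^sup>+xs. prod_list (map g xs) \<partial>replicate_pmf n P) = (\<integral>\<^sup>+x. g x \<partial>measure_pmf P) ^ n"
  by (induction n) (auto simp: nn_integral_cmult nn_integral_multc)

lemma nn_integral_replicate_update:
  "j < n \<Longrightarrow> (\<integral>\<^sup>+xs. prod_list (map g (xs[j := y])) \<partial>replicate_pmf n P) = g y * (\<integral>\<^sup>+x. g x \<partial>measure_pmf P) ^ (n - 1)"
proof (induction n arbitrary: j)
  case (Suc n)
  show ?case
  proof (cases j)
    case 0
    then show ?thesis by (simp add: nn_integral_cmult nn_integral_replicate_prod)
  next
    case (Suc i)
    then have "i < n" using Suc.prems by simp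
    then obtain n' where "n = Suc n'" by (cases n) auto
    then show ?thesis using Suc Suc.IH[OF \<open>i < n\<close>]
      by (simp add: nn_integral_cmult nn_integral_multc mult_ac)
  qed
qed simp

lemma nn_integral_replicate_Cons:
  "(\<integral>\<^sup>+xs. f xs \<partial>replicate_pmf (Suc n) P) = (\<integral>\<^sup>+x. \<integral>\<^sup>+xs. f (x # xs) \<partial>replicate_pmf n P \<partial>measure_pmf P)"
  by simp

lemma indicator_Cons: "indicator {u # us} (x # xs) = (indicator {u} x * indicator {us} xs :: ennreal)"
  by (simp split: split_indicator)

text \<open>Entry j is overwritten by the right value, so its factor is missing from the
  probability. It is supplied on the left instead of being divided out on the right, since it may
  vanish.\<close>

lemma nn_integral_replicate_update_indicator:
  "j < length us \<Longrightarrow> (\<integral>\<^sup>+xs. indicator {us} (xs[j := us ! j]) \<partial>replicate_pmf (length us) P) * ennreal (pmf P (us ! j))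
     = prod_list (map (\<lambda>u. ennreal (pmf P u)) us)"
proof (induction us arbitrary: j)
  case (Cons u us)
  have all: "(\<integral>\<^sup>+xs. indicator {us} xs \<partial>replicate_pmf (length us) P) = prod_list (map (\<lambda>u. ennreal (pmf P u)) us)" for us
  proof (induction us)
    case (Cons u us)
    then show ?case
      by (simp add: nn_integral_replicate_Cons indicator_Cons nn_integral_cmult nn_integral_multc emeasure_pmf_single
            del: replicate_pmf.simps)
  qed simp
  show ?case
  proof (cases j)
    case 0
    have "(\<integral>\<^sup>+xs. indicator {u # us} (xs[j := (u # us) ! j]) \<partial>replicate_pmf (length (u # us)) P)
        = (\<integral>\<^sup>+xs. indicator {us} xs \<partial>replicate_pmf (length us) P)"
      using 0 by (simp add: nn_integral_replicate_Cons indicator_Cons del: replicate_pmf.simps)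
    then show ?thesis unfolding all using 0 by (simp add: mult.commute)
  next
    case (Suc i)
    have "(\<integral>\<^sup>+xs. indicator {u # us} (xs[j := (u # us) ! j]) \<partial>replicate_pmf (length (u # us)) P)
        = ennreal (pmf P u) * (\<integral>\<^sup>+xs. indicator {us} (xs[i := us ! i]) \<partial>replicate_pmf (length us) P)"
      using Suc by (simp add: nn_integral_replicate_Cons indicator_Cons nn_integral_cmult nn_integral_multc emeasure_pmf_single
            del: replicate_pmf.simps)
    then show ?thesis using Suc Cons by (simp add: mult.assoc del: replicate_pmf.simps)
  qed
qed simp

lemma Bernoulli_le:
  fixes y :: real
  assumes "0 \<le> y" "y \<le> 1"
  shows "1 - real n * y \<le> (1 - y) ^ n"
  using Bernoulli_inequality[of "- y" n] assms by simp

text \<open>Exact for n = 2; each further factor costs y (1 - y)^n, at most y. The surplus y^2 over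
  the linear bound is the source of the square root in 1 - f(s) = O(sqrt(1 - s)).\<close>

lemma Bernoulli_quadratic:
  fixes y :: real
  assumes "0 \<le> y" "y \<le> 1" "2 \<le> n"
  shows "1 - real n * y + y\<^sup>2 \<le> (1 - y) ^ n"
  using assms(3)
proof (induction n rule: dec_induct)
  case base
  then show ?case by (simp add: power2_eq_square algebra_simps)
next
  case (step n)
  have "(1 - y) ^ Suc n = (1 - y) ^ n - y * (1 - y) ^ n" by (simp add: algebra_simps)
  moreover have "y * (1 - y) ^ n \<le> y * 1" using assms by (intro mult_left_mono power_le_one) auto
  ultimately show ?case using step by (simp add: algebra_simps)
qed

section \<open>Total progeny, and the law and size of the pointed tree\<close>

context critical_offspring
begin

text \<open>Here y = 1 - f(s). In the fixed-point equation (1 - y)^k is bounded below by 1 - k y,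
  with an extra y^2 at a single index j; mean 1 then gives 1 - y >= s (1 - y) + s p(j) y^2.\<close>

lemma total_mass_deficit:
  assumes "0 < s" "s \<le> 1"
  obtains y where "0 \<le> y" "y \<le> 1" "total_mass (\<lambda>k. s * p k) = ennreal (1 - y)"
    "\<And>k. k \<ge> 2 \<Longrightarrow> s * p k * y\<^sup>2 \<le> 1 - s"
proof -
  have nn: "0 \<le> s * p k" for k using assms p_nonneg by simp
  have "(\<Sum>k. ennreal (s * p k)) = ennreal (s * 1)"
    by (intro suminf_ennreal_eq[OF nn] sums_mult p_sums)
  then have "total_mass (\<lambda>k. s * p k) \<le> 1"
    using assms by (intro total_mass_le_1 nn) simp
  then obtain x where x: "total_mass (\<lambda>k. s * p k) = ennreal x" "0 \<le> x" "x \<le> 1"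
    by (cases "total_mass (\<lambda>k. s * p k)") (auto simp: ennreal_le_1 top_unique)
  have sm: "summable (\<lambda>k. s * p k * x ^ k)"
  proof (rule summable_comparison_test'[where g = "\<lambda>k. s * p k"])
    show "summable (\<lambda>k. s * p k)" using p_sums by (intro summable_mult) (auto simp: sums_iff)
    show "norm (s * p k * x ^ k) \<le> s * p k" for k
      using nn[of k] x mult_left_le[of "x ^ k" "s * p k"] by (simp add: power_le_one)
  qed
  have nn': "0 \<le> s * p k * x ^ k" for k using nn x by simp
  have "ennreal x = (\<Sum>k. ennreal (s * p k) * ennreal x ^ k)"
    using total_mass_fixpoint[of "\<lambda>k. s * p k", OF nn] unfolding x .
  also have "\<dots> = (\<Sum>k. ennreal (s * p k * x ^ k))"
    by (simp only: ennreal_power[OF x(2)] ennreal_mult[OF nn zero_le_power[OF x(2)]])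
  also have "\<dots> = ennreal (\<Sum>k. s * p k * x ^ k)"
    by (rule suminf_ennreal2[OF nn' sm])
  finally have eq: "x = (\<Sum>k. s * p k * x ^ k)"
    by (subst (asm) ennreal_inj[OF x(2) suminf_nonneg[OF sm nn']])
  define y where "y = 1 - x"
  have y: "0 \<le> y" "y \<le> 1" using x by (auto simp: y_def)
  have "s * p j * y\<^sup>2 \<le> 1 - s" if j: "j \<ge> 2" for j
  proof -
    have lo: "(\<lambda>k. s * (p k - y * (real k * p k)) + (if k = j then s * p k * y\<^sup>2 else 0)) sums
        (s * (1 - y * 1) + s * p j * y\<^sup>2)"
      by (intro sums_add sums_mult sums_diff p_sums p_mean sums_single)
    have up: "(\<lambda>k. s * p k * x ^ k) sums x" using sm eq by (simp add: sums_iff)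
    have "s * (p k - y * (real k * p k)) + (if k = j then s * p k * y\<^sup>2 else 0) \<le> s * p k * x ^ k" for k
    proof -
      have "1 - real k * y + (if k = j then y\<^sup>2 else 0) \<le> (1 - y) ^ k"
        using Bernoulli_le[OF y, of k] Bernoulli_quadratic[OF y, of k] j by auto
      from mult_left_mono[OF this nn[of k]] show ?thesis by (auto simp: y_def algebra_simps)
    qed
    from sums_le[OF this lo up] have "s * (1 - y * 1) + s * p j * y\<^sup>2 \<le> x" .
    then have "s * p j * y\<^sup>2 \<le> (1 - s) * x" by (simp add: y_def algebra_simps)
    also have "\<dots> \<le> (1 - s) * 1" using x assms by (intro mult_left_mono) auto
    finally show ?thesis by simp
  qed
  then show thesis using that[of y] y x by (simp add: y_def)
qed

text \<open>At s = 1 the deficit bound leaves only y = 0: critical trees are almost surely finite,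
  so the weights of finite trees form a probability law.\<close>

lemma total_mass_eq_1: "total_mass p = 1"
proof -
  obtain y where y: "total_mass (\<lambda>k. 1 * p k) = ennreal (1 - y)" "\<And>k. k \<ge> 2 \<Longrightarrow> 1 * p k * y\<^sup>2 \<le> 1 - 1"
    by (rule total_mass_deficit[of 1]) auto
  obtain k where k: "k \<ge> 2" "0 < p k" using ex_ge_2 by blast
  have "p k * y\<^sup>2 \<le> 0" using y(2)[OF k(1)] by simp
  then have "y = 0" using k(2) by (simp add: mult_le_0_iff)
  then show ?thesis using y by simp
qed

lemma pmf_GW: "pmf (GW p) t = tweight p t"
  unfolding GW_def
  by (rule pmf_embed_pmf) (use total_mass_eq_1 p_nonneg in \<open>auto simp: total_mass_def tweight_nonneg\<close>)

lemma nn_integral_GW_power: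
  assumes "0 \<le> s"
  shows "(\<integral>\<^sup>+t. ennreal (s ^ tsize t) \<partial>measure_pmf (GW p)) = total_mass (\<lambda>k. s * p k)"
  unfolding measure_pmf_eq_density total_mass_def
  using assms
  by (subst nn_integral_density)
     (auto simp: pmf_GW tweight_scale ennreal_mult tweight_nonneg p_nonneg mult.commute intro!: nn_integral_cong)

lemma pmf_size_biased: "pmf (size_biased p) k = real k * p k"
  unfolding size_biased_def
proof (rule pmf_embed_pmf)
  have "(\<integral>\<^sup>+ x. ennreal (real x * p x) \<partial>count_space UNIV) = (\<Sum>x. ennreal (real x * p x))"
    by (rule nn_integral_count_space_nat)
  also have "\<dots> = ennreal 1" by (rule suminf_ennreal_eq[OF _ p_mean]) (simp add: p_nonneg)
  finally show "(\<integral>\<^sup>+ x. ennreal (real x * p x) \<partial>count_space UNIV) = 1" by simp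
qed (simp add: p_nonneg)

lemma set_size_biased: "k \<in> set_pmf (size_biased p) \<Longrightarrow> 0 < k"
  by (rule ccontr) (auto simp: set_pmf_iff pmf_size_biased)

text \<open>At a spine vertex with d children, the size-biased weight d p(d) times the probability
  1/d of the chosen child is p(d). The other subtrees contribute their own weights, so no trace of
  the spine remains.\<close>

lemma pmf_Hstar:
  "pmf (Hstar p k) (t, v) = (if v \<in> vertices t \<and> length v = k then tweight p t else 0)"
proof (induction k arbitrary: t v)
  case 0
  have "pmf (Hstar p 0) (t, v) = (if v = [] then tweight p t else 0)"
    using pmf_map_inj'[of "\<lambda>t. (t, [])" "GW p" t]
    by (auto simp: pmf_GW inj_on_def pmf_eq_0_set_pmf)
  then show ?case by auto
next
  case (Suc k)
  obtain us where t: "t = Node us" by (cases t)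
  show ?case
  proof (cases v)
    case Nil
    then show ?thesis by (auto simp: pmf_eq_0_set_pmf)
  next
    case (Cons l v')
    let ?D = "length us"
    let ?I = "indicator {(t, v)} :: pointed_tree \<Rightarrow> ennreal"
    let ?R = "\<lambda>d j tv. \<integral>\<^sup>+ts. ?I (Node (ts[j := fst tv]), j # snd tv) \<partial>replicate_pmf d (GW p)"
    \<comment> \<open>The outcome determines degree, index and spine subtree, so each outer integral
      collapses to one point. For j >= d the list update does nothing and leaves \<open>tv\<close>
      undetermined, whence the guard \<open>j < d\<close>.\<close>
    have R0: "?R d j tv = 0" if "d \<noteq> ?D \<or> j \<noteq> l \<or> (j < d \<and> tv \<noteq> (us ! l, v'))" for d j tv
    proof -
      have "?R d j tv = (\<integral>\<^sup>+ts. 0 \<partial>replicate_pmf d (GW p))"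
        using that
        by (intro nn_integral_cong_AE) (cases tv; auto simp: AE_measure_pmf_iff set_replicate_pmf t Cons split: split_indicator)
      then show ?thesis by simp
    qed
    have "ennreal (pmf (Hstar p (Suc k)) (t, v)) = (\<integral>\<^sup>+x. ?I x \<partial>Hstar p (Suc k))"
      by (simp add: emeasure_pmf_single del: Hstar.simps)
    also have "\<dots> = (\<integral>\<^sup>+d. \<integral>\<^sup>+j. \<integral>\<^sup>+tv. ?R d j tv \<partial>Hstar p k \<partial>pmf_of_set {..<d} \<partial>size_biased p)"
      by (simp only: Hstar.simps nn_integral_bind_pmf nn_integral_return_pmf zero_le)
    also have "\<dots> = ennreal (pmf (size_biased p) ?D) *
        (\<integral>\<^sup>+j. \<integral>\<^sup>+tv. ?R ?D j tv \<partial>Hstar p k \<partial>pmf_of_set {..<?D})"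
      by (rule nn_integral_pmf_single) (simp add: R0)
    also have "\<dots> = (if v \<in> vertices t \<and> length v = Suc k then ennreal (tweight p t) else 0)"
    \<comment> \<open>Degree 0 has size-biased weight 0, so the uniform choice from an empty set
      does not matter.\<close>
    proof (cases "?D = 0")
      case True
      then show ?thesis by (auto simp: pmf_size_biased t Cons Cons_in_vertices)
    next
      case False
      then have ne: "{..<?D} \<noteq> {}" by auto
      have "(\<integral>\<^sup>+j. \<integral>\<^sup>+tv. ?R ?D j tv \<partial>Hstar p k \<partial>pmf_of_set {..<?D})
          = ennreal (pmf (pmf_of_set {..<?D}) l) * (\<integral>\<^sup>+tv. ?R ?D l tv \<partial>Hstar p k)"
        by (rule nn_integral_pmf_single) (simp add: R0)
      also have "ennreal (pmf (size_biased p) ?D) * \<dots>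
          = (if l < ?D then ennreal (p ?D) else 0) * (\<integral>\<^sup>+tv. ?R ?D l tv \<partial>Hstar p k)"
        using False ne p_nonneg[of ?D]
        by (auto simp: pmf_size_biased mult.assoc[symmetric] ennreal_mult[symmetric])
      also have "\<dots> = (if v \<in> vertices t \<and> length v = Suc k then ennreal (tweight p t) else 0)"
      proof (cases "l < ?D")
        case True
        have "(\<integral>\<^sup>+tv. ?R ?D l tv \<partial>Hstar p k) = ennreal (pmf (Hstar p k) (us ! l, v')) * ?R ?D l (us ! l, v')"
          using True by (intro nn_integral_pmf_single R0) auto
        also have "?R ?D l (us ! l, v') = (\<integral>\<^sup>+ts. indicator {us} (ts[l := us ! l]) \<partial>replicate_pmf ?D (GW p))"
          by (simp add: t Cons indicator_def)
        finally have "(\<integral>\<^sup>+tv. ?R ?D l tv \<partial>Hstar p k)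
            = (if v' \<in> vertices (us ! l) \<and> length v' = k then
                prod_list (map (\<lambda>u. ennreal (tweight p u)) us) else 0)"
          using nn_integral_replicate_update_indicator[OF True, of "GW p"]
          by (simp add: Suc.IH pmf_GW mult.commute)
        then show ?thesis
          using True by (auto simp: t Cons Cons_in_vertices ennreal_tweight_Node[OF p_nonneg] simp del: tweight.simps)
      qed (auto simp: t Cons Cons_in_vertices)
      finally show ?thesis .
    qed
    finally show ?thesis
      using tweight_nonneg[of p t, OF p_nonneg] by (auto split: if_splits)
  qed
qed

text \<open>Apply Bernoulli to (1 - y)^(d-1). The size-biased mean is E[xi^2] =
  \<open>sigma2\<close> + 1, so a spine vertex has on average \<open>sigma2\<close> children off the
  spine.\<close>

lemma nn_integral_size_biased_power:
  assumes "0 \<le> y" "y \<le> 1"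
  shows "ennreal (1 - sigma2 * y) \<le> (\<integral>\<^sup>+d. ennreal (1 - y) ^ (d - 1) \<partial>size_biased p)"
proof -
  have nn: "0 \<le> real d * p d" for d using p_nonneg by simp
  have sm: "summable (\<lambda>d. real d * p d * (1 - y) ^ (d - 1))"
  proof (rule summable_comparison_test'[where g = "\<lambda>d. real d * p d"])
    show "summable (\<lambda>d. real d * p d)" using p_mean by (auto simp: sums_iff)
    show "norm (real d * p d * (1 - y) ^ (d - 1)) \<le> real d * p d" for d
      using nn[of d] assms mult_left_le[of "(1 - y) ^ (d - 1)" "real d * p d"] by (simp add: power_le_one abs_mult p_nonneg)
  qed
  have "(\<integral>\<^sup>+d. ennreal (1 - y) ^ (d - 1) \<partial>size_biased p)
      = (\<integral>\<^sup>+d. ennreal (real d * p d * (1 - y) ^ (d - 1)) \<partial>count_space UNIV)"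
    unfolding measure_pmf_eq_density using assms nn
    by (subst nn_integral_density) (auto simp: pmf_size_biased ennreal_mult ennreal_power)
  also have "\<dots> = (\<Sum>d. ennreal (real d * p d * (1 - y) ^ (d - 1)))"
    by (rule nn_integral_count_space_nat)
  also have "\<dots> = ennreal (\<Sum>d. real d * p d * (1 - y) ^ (d - 1))"
    using nn assms by (intro suminf_ennreal2 sm) auto
  finally have eq: "(\<integral>\<^sup>+d. ennreal (1 - y) ^ (d - 1) \<partial>size_biased p) = ennreal (\<Sum>d. real d * p d * (1 - y) ^ (d - 1))" .
  have lo: "(\<lambda>d. real d * p d - y * ((real d)\<^sup>2 * p d - real d * p d)) sums (1 - y * (sigma2 + 1 - 1))"
    by (intro sums_diff sums_mult p_mean square_sums)
  have "real d * p d - y * ((real d)\<^sup>2 * p d - real d * p d) \<le> real d * p d * (1 - y) ^ (d - 1)" for d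
  proof (cases d)
    case (Suc e)
    from mult_left_mono[OF Bernoulli_le[OF assms, of e] nn[of d]]
    show ?thesis unfolding Suc by (simp add: algebra_simps power2_eq_square)
  qed simp
  from sums_le[OF this lo summable_sums[OF sm]]
  have "1 - y * (sigma2 + 1 - 1) \<le> (\<Sum>d. real d * p d * (1 - y) ^ (d - 1))" .
  then show ?thesis unfolding eq by (intro ennreal_leI) (simp add: mult.commute)
qed

text \<open>Each of the k spine vertices above u_0 contributes s for itself and a factor 1 - y for
  every child off the spine. The \<open>max 0\<close> keeps the base of the power nonnegative when
  \<open>sigma2\<close> y exceeds 1.\<close>

lemma nn_integral_Hstar_power:
  assumes "0 \<le> s" and y: "0 \<le> y" "y \<le> 1" "total_mass (\<lambda>k. s * p k) = ennreal (1 - y)"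
  shows "ennreal (max 0 (s * (1 - sigma2 * y)) ^ k * (1 - y)) \<le> (\<integral>\<^sup>+tv. ennreal (s ^ tsize (fst tv)) \<partial>Hstar p k)"
proof (induction k)
  case 0
  then show ?case using y assms(1) by (simp add: nn_integral_GW_power)
next
  case (Suc k)
  let ?g = "\<lambda>t. ennreal (s ^ tsize t)"
  let ?e = "\<integral>\<^sup>+tv. ?g (fst tv) \<partial>Hstar p k"
  have node: "?g (Node ts) = ennreal s * prod_list (map ?g ts)" for ts
  proof -
    have "?g (Node ts) = ennreal s * ennreal (s ^ sum_list (map tsize ts))"
      using assms(1) by (simp add: ennreal_mult)
    also have "ennreal (s ^ sum_list (map tsize ts)) = prod_list (map ?g ts)"
      using assms(1) by (induction ts) (auto simp: power_add ennreal_mult)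
    finally show ?thesis .
  qed
  have "(\<integral>\<^sup>+tv. ?g (fst tv) \<partial>Hstar p (Suc k))
      = (\<integral>\<^sup>+d. \<integral>\<^sup>+j. \<integral>\<^sup>+tv. \<integral>\<^sup>+ts. ?g (Node (ts[j := fst tv])) \<partial>replicate_pmf d (GW p)
           \<partial>Hstar p k \<partial>pmf_of_set {..<d} \<partial>size_biased p)"
    by (simp del: tsize.simps)
  also have "\<dots> = (\<integral>\<^sup>+d. ennreal s * ?e * ennreal (1 - y) ^ (d - 1) \<partial>size_biased p)"
  proof (rule nn_integral_cong_AE, unfold AE_measure_pmf_iff, rule ballI)
    fix d assume "d \<in> set_pmf (size_biased p)"
    then have ne: "{..<d} \<noteq> {}" using set_size_biased by auto
    have "(\<integral>\<^sup>+j. \<integral>\<^sup>+tv. \<integral>\<^sup>+ts. ?g (Node (ts[j := fst tv])) \<partial>replicate_pmf d (GW p) \<partial>Hstar p k \<partial>pmf_of_set {..<d})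
        = (\<integral>\<^sup>+j. ennreal s * ?e * ennreal (1 - y) ^ (d - 1) \<partial>pmf_of_set {..<d})"
    proof (rule nn_integral_cong_AE, unfold AE_measure_pmf_iff, rule ballI)
      fix j assume "j \<in> set_pmf (pmf_of_set {..<d})"
      then have j: "j < d" using ne by (simp add: set_pmf_of_set)
      have "(\<integral>\<^sup>+ts. ?g (Node (ts[j := t])) \<partial>replicate_pmf d (GW p)) = ennreal s * ?g t * ennreal (1 - y) ^ (d - 1)" for t
        unfolding node
        by (simp add: nn_integral_cmult nn_integral_replicate_update[OF j] nn_integral_GW_power[OF assms(1)] y mult.assoc)
      then show "(\<integral>\<^sup>+tv. \<integral>\<^sup>+ts. ?g (Node (ts[j := fst tv])) \<partial>replicate_pmf d (GW p) \<partial>Hstar p k)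
          = ennreal s * ?e * ennreal (1 - y) ^ (d - 1)"
        by (simp add: nn_integral_cmult nn_integral_multc del: tsize.simps)
    qed
    then show "(\<integral>\<^sup>+j. \<integral>\<^sup>+tv. \<integral>\<^sup>+ts. ?g (Node (ts[j := fst tv])) \<partial>replicate_pmf d (GW p) \<partial>Hstar p k \<partial>pmf_of_set {..<d})
        = ennreal s * ?e * ennreal (1 - y) ^ (d - 1)" by simp
  qed
  also have "\<dots> = ennreal s * ?e * (\<integral>\<^sup>+d. ennreal (1 - y) ^ (d - 1) \<partial>size_biased p)"
    by (rule nn_integral_cmult) simp
  also have "\<dots> \<ge> ennreal s * ?e * ennreal (1 - sigma2 * y)"
    by (intro mult_left_mono nn_integral_size_biased_power y) simp
  finally have 1: "ennreal s * ?e * ennreal (1 - sigma2 * y) \<le> (\<integral>\<^sup>+tv. ?g (fst tv) \<partial>Hstar p (Suc k))" .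
  define r where "r = max 0 (s * (1 - sigma2 * y))"
  have r: "0 \<le> r" "ennreal r = ennreal s * ennreal (1 - sigma2 * y)"
    using assms(1) by (auto simp: r_def ennreal_mult'[symmetric])
  have "ennreal (r ^ Suc k * (1 - y)) = ennreal r * ennreal (r ^ k * (1 - y))"
    using y r(1) by (simp add: ennreal_mult[symmetric] mult.assoc)
  also have "\<dots> \<le> ennreal r * ?e"
    using Suc unfolding r_def by (intro mult_left_mono) auto
  finally show ?case using 1 unfolding r(2) r_def[symmetric] by (simp add: mult_ac)
qed

text \<open>Take s = 1 - 1/n. On the event in question s^size is at most exp(-1/2), so its
  probability is controlled by 1 - E[s^size], and every spine step adds only O(1/sqrt n) to
  that.\<close>

lemma Hstar_size_tail:
  obtains C where "0 < C"
    "\<And>n k. 2 \<le> n \<Longrightarrow> measure_pmf.prob (Hstar p k) {tv. real n / 2 < real (tsize (fst tv))} \<le> C * (real k + 1) / sqrt n"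
proof -
  obtain l where l: "l \<ge> 2" "0 < p l" using ex_ge_2 by blast
  \<comment> \<open>Chosen so that s p(l) y^2 <= 1/n and s >= 1/2 will give y <= B / sqrt n.\<close>
  define B where "B = sqrt (2 / p l)"
  have B: "0 < B" using l by (simp add: B_def)
  define \<kappa> where "\<kappa> = 1 - exp (- 1 / 2 :: real)"
  have \<kappa>: "0 < \<kappa>" by (simp add: \<kappa>_def)
  let ?C = "(1 + sigma2 * B + B) / \<kappa>"
  have "measure_pmf.prob (Hstar p k) {tv. real n / 2 < real (tsize (fst tv))} \<le> ?C * (real k + 1) / sqrt n"
    if n: "2 \<le> n" for n k
  proof -
    define s where "s = 1 - 1 / real n"
    have s: "1 / 2 \<le> s" "s \<le> 1" "0 < s" using n by (auto simp: s_def field_simps)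
    obtain y where y: "0 \<le> y" "y \<le> 1" "total_mass (\<lambda>k. s * p k) = ennreal (1 - y)"
      "s * p l * y\<^sup>2 \<le> 1 - s"
      using total_mass_deficit[OF s(3,2)] l(1) by metis
    have "p l / 2 * y\<^sup>2 \<le> s * p l * y\<^sup>2" using s l by (intro mult_right_mono) auto
    also have "\<dots> \<le> 1 / n" using y(4) by (simp add: s_def)
    finally have "y\<^sup>2 \<le> (B / sqrt n)\<^sup>2" using l n by (simp add: B_def power_divide field_simps)
    then have yB: "y \<le> B / sqrt n" by (rule power2_le_imp_le) (use B in simp)
    define r where "r = max 0 (s * (1 - sigma2 * y))"
    have "s * (sigma2 * y) \<le> sigma2 * y" using s y sigma2_pos by (intro mult_left_le_one_le) auto
    then have r: "0 \<le> r" "1 - r \<le> 1 / n + sigma2 * y"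
      by (auto simp: r_def s_def algebra_simps max_def split: if_splits)
    let ?f = "\<lambda>tv :: pointed_tree. s ^ tsize (fst tv)"
    define A where "A = {tv :: pointed_tree. real n / 2 < real (tsize (fst tv))}"
    have intA: "integrable (measure_pmf (Hstar p k)) (indicator A :: pointed_tree \<Rightarrow> real)"
      by (rule measure_pmf.integrable_const_bound[where B = 1]) (auto split: split_indicator)
    have fb: "0 \<le> ?f tv" "?f tv \<le> 1" for tv using s by (auto simp: power_le_one)
    have int: "integrable (measure_pmf (Hstar p k)) ?f"
      by (rule measure_pmf.integrable_const_bound[where B = 1]) (use fb in auto)
    have "ennreal (r ^ k * (1 - y)) \<le> (\<integral>\<^sup>+tv. ennreal (?f tv) \<partial>Hstar p k)"
      unfolding r_def using s y by (intro nn_integral_Hstar_power) auto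
    also have "\<dots> = ennreal (measure_pmf.expectation (Hstar p k) ?f)"
      by (rule nn_integral_eq_integral[OF int]) (use fb in auto)
    finally have "r ^ k * (1 - y) \<le> measure_pmf.expectation (Hstar p k) ?f"
      using fb by (subst (asm) ennreal_le_iff) (auto intro: integral_nonneg)
    also have "\<dots> \<le> measure_pmf.expectation (Hstar p k) (\<lambda>tv. 1 - \<kappa> * indicator A tv)"
    proof (rule integral_mono[OF int])
      show "integrable (measure_pmf (Hstar p k)) (\<lambda>tv. 1 - \<kappa> * indicator A tv)"
        using intA by simp
      fix tv
      show "?f tv \<le> 1 - \<kappa> * indicator A tv"
      proof (cases "tv \<in> A")
        case True
        have "?f tv \<le> exp (- (1 / n)) ^ tsize (fst tv)"
          using s exp_ge_add_one_self[of "- (1 / n)"] by (intro power_mono) (auto simp: s_def)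
        also have "\<dots> = exp (real (tsize (fst tv)) * - (1 / n))" by (rule exp_of_nat_mult[symmetric])
        also have "\<dots> \<le> exp (- 1 / 2)" using True n by (simp add: A_def field_simps)
        finally show ?thesis using True by (simp add: \<kappa>_def)
      qed (use fb in simp)
    qed
    also have "\<dots> = 1 - \<kappa> * measure_pmf.prob (Hstar p k) A"
      using intA by simp
    finally have 1: "\<kappa> * measure_pmf.prob (Hstar p k) A \<le> 1 - r ^ k * (1 - y)" by simp
    \<comment> \<open>Bernoulli again: k spine steps lose at most k times the loss of one.\<close>
    have "1 - real k * (1 - r) \<le> r ^ k"
      using Bernoulli_inequality[of "r - 1" k] r(1) by (simp add: algebra_simps)
    moreover have "real k * (1 - r) \<le> real k * (1 / n + sigma2 * y)"
      using r by (intro mult_left_mono) auto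
    moreover have "r ^ k * y \<le> 1 * y"
    proof (intro mult_right_mono power_le_one r y)
      have "s * (1 - sigma2 * y) \<le> s" using s y sigma2_pos by (intro mult_left_le) auto
      then have "s * (1 - sigma2 * y) \<le> 1" using s by linarith
      then show "r \<le> 1" by (simp add: r_def)
    qed
    ultimately have "1 - r ^ k * (1 - y) \<le> real k * (1 / n + sigma2 * y) + y"
      by (simp add: algebra_simps)
    also have "\<dots> \<le> real k * (1 / sqrt n + sigma2 * (B / sqrt n)) + B / sqrt n"
    proof -
      have "sqrt n \<le> real n" using n by (intro real_le_lsqrt) (auto simp: power2_eq_square)
      then have "1 / real n \<le> 1 / sqrt n" using n by (intro divide_left_mono) auto
      then show ?thesis using yB sigma2_pos by (intro add_mono mult_left_mono) auto
    qed
    also have "\<dots> = (real k * (1 + sigma2 * B) + B) / sqrt n"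
      using n by (simp add: field_simps)
    also have "\<dots> \<le> ((1 + sigma2 * B + B) * (real k + 1)) / sqrt n"
      using B sigma2_pos by (intro divide_right_mono) (auto simp: algebra_simps)
    finally have "\<kappa> * measure_pmf.prob (Hstar p k) A \<le> ((1 + sigma2 * B + B) * (real k + 1)) / sqrt n"
      using 1 by simp
    then have "measure_pmf.prob (Hstar p k) A \<le> ((1 + sigma2 * B + B) * (real k + 1)) / sqrt n / \<kappa>"
      using \<kappa> by (simp only: pos_le_divide_eq mult.commute)
    then show ?thesis by (simp add: A_def mult.commute)
  qed
  moreover have "0 < ?C" using B sigma2_pos \<kappa> by (intro divide_pos_pos add_pos_pos) auto
  ultimately show thesis using that by blast
qed

end

subsection \<open>Comparison of the two laws\<close>

lemma forests_1: "forests n 1 = (\<lambda>t. [t]) ` {t. tsize t = n}"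
  by (auto simp: forests_def length_Suc_conv)

lemma finite_trees: "finite {t. tsize t = n}"
  using finite_forests[of n 1] unfolding forests_1 by (rule finite_imageD) (simp add: inj_on_def)

lemma Zn_eq_forest_sum: "Zn p n = forest_sum p n 1"
  unfolding Zn_def forest_sum_def forests_1 by (subst sum.reindex) (auto simp: inj_on_def fweight_def)

lemma occ_sum_1: "occ_sum p t n 1 = (\<Sum>T\<in>{T. tsize T = n}. tweight p T * real (occ t T))"
  unfolding occ_sum_def forests_1 by (subst sum.reindex) (auto simp: inj_on_def fweight_def)

lemma pmf_Tn:
  assumes "\<And>k. 0 \<le> p k" "0 < Zn p n"
  shows "pmf (Tn p n) t = (if tsize t = n then tweight p t / Zn p n else 0)"
  unfolding Tn_def
proof (rule pmf_embed_pmf)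
  have nn: "0 \<le> tweight p t" for t using assms(1) by (rule tweight_nonneg)
  then show "0 \<le> (if tsize t = n then tweight p t / Zn p n else 0)" for t
    using assms(2) by simp
  have "(\<integral>\<^sup>+t. ennreal (if tsize t = n then tweight p t / Zn p n else 0) \<partial>count_space UNIV)
      = (\<Sum>t | tsize t = n. ennreal (if tsize t = n then tweight p t / Zn p n else 0))"
    by (rule nn_integral_count_space') (auto simp: finite_trees)
  also have "\<dots> = (\<Sum>t | tsize t = n. ennreal (tweight p t / Zn p n))"
    by (intro sum.cong) auto
  also have "\<dots> = ennreal (\<Sum>t | tsize t = n. tweight p t / Zn p n)"
    using nn assms(2) by (intro sum_ennreal) auto
  also have "(\<Sum>t | tsize t = n. tweight p t / Zn p n) = Zn p n / Zn p n"
    unfolding Zn_def[of p n] sum_divide_distrib ..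
  finally show "(\<integral>\<^sup>+t. ennreal (if tsize t = n then tweight p t / Zn p n else 0) \<partial>count_space UNIV) = 1"
    using assms(2) by simp
qed

text \<open>The expected number of copies of \<open>t\<close> is divided by n for the uniform
  vertex, and n Z_n is P(S_n = n-1) by \<open>forest_sum_walk\<close>; what remains is
  \<open>occ_sum\<close> for one tree over that probability.\<close>

lemma pmf_H_Tn:
  assumes "\<And>k. 0 \<le> p k" "0 < walk p n (n - 1)" "v \<in> vertices t" "length v = k" "tsize t \<le> n"
  shows "pmf (H_Tn p n k) (Some (t, v))
    = tweight p t * (walk p (n - tsize t) (n - tsize t) / walk p n (n - 1))"
proof -
  have n: "1 \<le> n" using assms(5) tsize_pos[of t] by simp
  have Z: "real n * Zn p n = walk p n (n - 1)"
    using forest_sum_walk[OF n, of p] by (simp add: Zn_eq_forest_sum)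
  then have Zpos: "0 < Zn p n" using assms(2) n by (metis zero_less_mult_pos of_nat_0_less_iff less_le_trans zero_less_one)
  have inner: "pmf (pmf_of_set (vertices T) \<bind> (\<lambda>v. return_pmf (H k T v))) (Some (t, v)) = real (occ t T) / real n"
    if "tsize T = n" for T
  proof -
    have "pmf (pmf_of_set (vertices T) \<bind> (\<lambda>v. return_pmf (H k T v))) (Some (t, v))
        = measure_pmf.prob (pmf_of_set (vertices T)) (H k T -` {Some (t, v)})"
      by (simp add: map_pmf_def[symmetric] pmf_map)
    also have "\<dots> = real (card (vertices T \<inter> H k T -` {Some (t, v)})) / real (card (vertices T))"
      using root_in_vertices[of T] by (intro measure_pmf_of_set finite_vertices) blast
    also have "vertices T \<inter> H k T -` {Some (t, v)} = {x \<in> vertices T. H k T x = Some (t, v)}" by auto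
    finally show ?thesis using that by (simp add: card_H_eq[OF assms(3,4)] card_vertices)
  qed
  have "pmf (H_Tn p n k) (Some (t, v))
      = (\<Sum>T | tsize T = n. pmf (pmf_of_set (vertices T) \<bind> (\<lambda>v. return_pmf (H k T v))) (Some (t, v)) * pmf (Tn p n) T)"
    unfolding H_Tn_def pmf_bind[of "Tn p n"]
    by (rule integral_measure_pmf_real[OF finite_trees])
       (auto simp: set_pmf_iff pmf_Tn[OF assms(1) Zpos] split: if_splits)
  also have "\<dots> = (\<Sum>T | tsize T = n. tweight p T * real (occ t T) / (real n * Zn p n))"
    by (intro sum.cong refl) (auto simp: inner pmf_Tn[OF assms(1) Zpos])
  also have "\<dots> = occ_sum p t n 1 / walk p n (n - 1)"
    unfolding occ_sum_1 sum_divide_distrib Z ..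
  also have "occ_sum p t n 1 = tweight p t * walk p (n - tsize t) (n - tsize t)"
    using assms(5) by (simp add: occ_sum_walk)
  finally show ?thesis by simp
qed

text \<open>Outdegrees sum to the size minus 1, so tilting multiplies the weight by a factor that
  depends on the size alone. Conditioning on the size cancels it in
  \<open>Tn_offspring\<close>.\<close>

lemma tweight_offspring:
  assumes "\<tau> \<noteq> 0"
  shows "tweight (offspring w \<tau>) t = tweight w t * ((\<tau> / phi w \<tau>) ^ tsize t / \<tau>)"
proof -
  \<comment> \<open>With the extra factor tau every tree carries one tau per vertex; the power tau^k
    at a root of degree k supplies the extra factors of its k subtrees.\<close>
  have "tweight (offspring w \<tau>) t * \<tau> = tweight w t * (\<tau> / phi w \<tau>) ^ tsize t"
  proof (induction t)
    case (Node ts)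
    have "prod_list (map (tweight (offspring w \<tau>)) ts) * \<tau> ^ length ts
        = prod_list (map (tweight w) ts) * (\<tau> / phi w \<tau>) ^ sum_list (map tsize ts)"
      using Node
    proof (induction ts)
      case (Cons t ts)
      have "prod_list (map (tweight (offspring w \<tau>)) (t # ts)) * \<tau> ^ length (t # ts)
          = (tweight (offspring w \<tau>) t * \<tau>) * (prod_list (map (tweight (offspring w \<tau>)) ts) * \<tau> ^ length ts)"
        by (simp add: mult_ac)
      also have "\<dots> = (tweight w t * (\<tau> / phi w \<tau>) ^ tsize t) *
          (prod_list (map (tweight w) ts) * (\<tau> / phi w \<tau>) ^ sum_list (map tsize ts))"
        using Cons by simp
      finally show ?case by (simp add: power_add mult_ac)
    qed simp
    moreover have "tweight (offspring w \<tau>) (Node ts) * \<tau>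
        = w (length ts) * (\<tau> / phi w \<tau>) * (prod_list (map (tweight (offspring w \<tau>)) ts) * \<tau> ^ length ts)"
      by (simp add: offspring_def mult_ac)
    ultimately show ?case by (simp add: mult_ac)
  qed
  then show ?thesis using assms by (metis nonzero_mult_div_cancel_right times_divide_eq_right)
qed

lemma Tn_offspring:
  assumes "\<tau> \<noteq> 0" "phi w \<tau> \<noteq> 0"
  shows "Tn (offspring w \<tau>) n = Tn w n"
proof -
  define c where "c = (\<tau> / phi w \<tau>) ^ n / \<tau>"
  have c: "c \<noteq> 0" using assms by (simp add: c_def)
  have "Zn (offspring w \<tau>) n = Zn w n * c"
    unfolding Zn_def sum_distrib_right
    by (intro sum.cong) (auto simp: tweight_offspring[OF assms(1)] c_def)
  then have "(if tsize t = n then tweight (offspring w \<tau>) t / Zn (offspring w \<tau>) n else 0)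
      = (if tsize t = n then tweight w t / Zn w n else 0)" for t
    using c by (auto simp: tweight_offspring[OF assms(1)] c_def[symmetric])
  then show ?thesis unfolding Tn_def by presburger
qed

text \<open>A one-sided bound suffices: it gives P(A) >= Q(A) - eta - delta for every event A, and
  the complement of A yields the other side. Thus the placeholder and the large trees under T_n
  require no separate estimate.\<close>

lemma dTV_le:
  assumes "0 \<le> \<delta>" "\<delta> \<le> 1"
    and good: "\<And>a. a \<in> G \<Longrightarrow> (1 - \<delta>) * pmf Q a \<le> pmf P a"
    and bad: "measure_pmf.prob Q (- G) \<le> \<eta>"
  shows "dTV P Q \<le> \<eta> + \<delta>"
proof -
  have lower: "measure_pmf.prob Q A - (\<eta> + \<delta>) \<le> measure_pmf.prob P A" for A
  proof -
    let ?B = "A \<inter> G"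
    have "ennreal ((1 - \<delta>) * measure_pmf.prob Q ?B) = ennreal (1 - \<delta>) * (\<integral>\<^sup>+x. ennreal (pmf Q x) \<partial>count_space ?B)"
      using assms by (simp add: ennreal_mult nn_integral_pmf measure_pmf.emeasure_eq_measure)
    also have "\<dots> = (\<integral>\<^sup>+x. ennreal ((1 - \<delta>) * pmf Q x) \<partial>count_space ?B)"
      using assms by (simp add: ennreal_mult nn_integral_cmult)
    also have "\<dots> \<le> (\<integral>\<^sup>+x. ennreal (pmf P x) \<partial>count_space ?B)"
      by (intro nn_integral_mono ennreal_leI good) auto
    also have "\<dots> = ennreal (measure_pmf.prob P ?B)"
      by (simp add: nn_integral_pmf measure_pmf.emeasure_eq_measure)
    finally have "(1 - \<delta>) * measure_pmf.prob Q ?B \<le> measure_pmf.prob P ?B"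
      by (subst (asm) ennreal_le_iff) auto
    moreover have "measure_pmf.prob P ?B \<le> measure_pmf.prob P A"
      by (intro measure_pmf.finite_measure_mono) auto
    moreover have "\<delta> * measure_pmf.prob Q ?B \<le> \<delta> * 1"
      using assms by (intro mult_left_mono) auto
    moreover have "measure_pmf.prob Q A \<le> measure_pmf.prob Q (?B \<union> - G)"
      by (intro measure_pmf.finite_measure_mono) auto
    moreover have "measure_pmf.prob Q (?B \<union> - G) \<le> measure_pmf.prob Q ?B + measure_pmf.prob Q (- G)"
      by (rule measure_Un_le) auto
    ultimately show ?thesis using bad by (simp add: left_diff_distrib)
  qed
  have "\<bar>measure_pmf.prob P A - measure_pmf.prob Q A\<bar> \<le> \<eta> + \<delta>" for A
    using lower[of A] lower[of "- A"]
      measure_pmf.prob_compl[of A P] measure_pmf.prob_compl[of A Q]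
    by (simp add: Compl_eq_Diff_UNIV abs_le_iff)
  then show ?thesis unfolding dTV_def by (intro cSUP_least) auto
qed

text \<open>The size minus 1 is the sum of the outdegrees, each a multiple of d. This provides the
  divisibility of n - m that the local limit theorem asks for.\<close>

lemma dvd_tsize_of_tweight_nonzero:
  assumes "\<And>k. p k \<noteq> 0 \<Longrightarrow> d dvd k" "tweight p t \<noteq> 0"
  shows "d dvd tsize t - 1"
  using assms(2)
proof (induction t)
  case (Node ts)
  then have nz: "p (length ts) \<noteq> 0" "\<And>t. t \<in> set ts \<Longrightarrow> tweight p t \<noteq> 0"
    by (auto simp: prod_list_zero_iff)
  have "sum_list (map tsize ts) = length ts + sum_list (map (\<lambda>t. tsize t - 1) ts)"
    by (induction ts) (use tsize_pos in \<open>auto simp: Suc_le_eq\<close>)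
  moreover have "d dvd sum_list (map (\<lambda>t. tsize t - 1) ts)"
    using Node.IH nz(2) by (induction ts) auto
  ultimately show ?case using assms(1)[OF nz(1)] by simp
qed

section \<open>The quantitative bound and the limit theorem\<close>

context critical_offspring
begin

lemma dTV_Hstar_le:
  assumes "0 < \<delta>" "\<delta> \<le> 1"
  obtains N C where "0 < C"
    "\<And>n k. N \<le> n \<Longrightarrow> d dvd n - 1 \<Longrightarrow>
       dTV (H_Tn p n k) (map_pmf Some (Hstar p k)) \<le> C * (real k + 1) / sqrt n + \<delta>"
proof -
  \<comment> \<open>Chosen so that (1 - delta)(L + eta) <= L - eta for L =
    \<open>llt_const\<close>.\<close>
  define \<eta> where "\<eta> = llt_const * \<delta> / 2"
  have \<eta>: "0 < \<eta>" "\<eta> < llt_const" using assms llt_const_pos by (auto simp: \<eta>_def)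
  obtain N0 where N0: "\<And>n. n \<ge> N0 \<Longrightarrow> d dvd n \<Longrightarrow> \<bar>sqrt n * walk p n n - llt_const\<bar> < \<eta>"
    using local_limit[OF \<eta>(1), of 0] by auto
  obtain N1 where N1: "\<And>n. n \<ge> N1 \<Longrightarrow> 1 \<le> n \<Longrightarrow> d dvd n - 1 \<Longrightarrow> \<bar>sqrt n * walk p n (n - 1) - llt_const\<bar> < \<eta>"
    using local_limit[OF \<eta>(1), of 1] by blast
  obtain C where C: "0 < C"
    "\<And>n k. 2 \<le> n \<Longrightarrow> measure_pmf.prob (Hstar p k) {tv. real n / 2 < real (tsize (fst tv))} \<le> C * (real k + 1) / sqrt n"
    by (rule Hstar_size_tail) blast
  \<comment> \<open>The threshold \<open>2 * N0\<close> serves the numerator, whose index n - m is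
    at least n/2.\<close>
  have "dTV (H_Tn p n k) (map_pmf Some (Hstar p k)) \<le> C * (real k + 1) / sqrt n + \<delta>"
    if n: "max (2 * N0) (max N1 2) \<le> n" "d dvd n - 1" for n k
  proof -
    define A where "A = {tv \<in> set_pmf (Hstar p k). real (tsize (fst tv)) \<le> real n / 2}"
    have n2: "2 \<le> n" "N1 \<le> n" "2 * N0 \<le> n" using n(1) by auto
    have wn: "llt_const - \<eta> < sqrt n * walk p n (n - 1)" "sqrt n * walk p n (n - 1) < llt_const + \<eta>"
      using N1[of n] n2 n(2) by (auto simp: abs_less_iff)
    then have "0 < sqrt n * walk p n (n - 1)" using \<eta> by linarith
    then have wpos: "0 < walk p n (n - 1)" using n2 by (simp add: zero_less_mult_iff)
    show ?thesis
    proof (rule dTV_le)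
      fix a assume "a \<in> Some ` A"
      then obtain t v where a: "a = Some (t, v)" and tv: "(t, v) \<in> A" by auto
      have "pmf (Hstar p k) (t, v) \<noteq> 0" using tv by (simp add: A_def set_pmf_iff)
      then have valid: "v \<in> vertices t" "length v = k" "tweight p t \<noteq> 0"
        by (auto simp: pmf_Hstar split: if_splits)
      have Q: "pmf (map_pmf Some (Hstar p k)) a = tweight p t"
        using valid by (simp add: a pmf_map_inj' pmf_Hstar)
      define m where "m = tsize t"
      have m: "2 * m \<le> n" "0 < m" using tv tsize_pos[of t] by (auto simp: A_def m_def)
      have "d dvd m - 1" unfolding m_def using p_nonzero_dvd valid(3) by (rule dvd_tsize_of_tweight_nonzero)
      then have "d dvd (n - 1) - (m - 1)" using n(2) by (rule dvd_diff_nat[rotated])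
      then have dvd: "d dvd n - m" using m by simp
      have "\<bar>sqrt (n - m) * walk p (n - m) (n - m) - llt_const\<bar> < \<eta>"
        using m n2 by (intro N0 dvd) auto
      then have "llt_const - \<eta> \<le> sqrt (n - m) * walk p (n - m) (n - m)" by (simp add: abs_less_iff)
      \<comment> \<open>Only a lower bound on the ratio is sought, so sqrt (n - m) may be enlarged
        to sqrt n.\<close>
      also have "\<dots> \<le> sqrt n * walk p (n - m) (n - m)"
        using walk_nonneg[of p, OF p_nonneg] by (intro mult_right_mono) auto
      finally have "(1 - \<delta>) * (sqrt n * walk p n (n - 1)) \<le> sqrt n * walk p (n - m) (n - m)"
      proof (rule order_trans[rotated])
        have "(1 - \<delta>) * (sqrt n * walk p n (n - 1)) \<le> (1 - \<delta>) * (llt_const + \<eta>)"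
          using wn assms by (intro mult_left_mono) auto
        also have "\<dots> \<le> llt_const - \<eta>"
          using llt_const_pos assms by (simp add: \<eta>_def field_simps)
        finally show "(1 - \<delta>) * (sqrt n * walk p n (n - 1)) \<le> llt_const - \<eta>" .
      qed
      then have "sqrt n * ((1 - \<delta>) * walk p n (n - 1)) \<le> sqrt n * walk p (n - m) (n - m)"
        by (simp only: mult.left_commute)
      then have "(1 - \<delta>) * walk p n (n - 1) \<le> walk p (n - m) (n - m)"
        using n2 by simp
      then have "1 - \<delta> \<le> walk p (n - m) (n - m) / walk p n (n - 1)"
        using wpos by (simp add: pos_le_divide_eq)
      then have "tweight p t * (1 - \<delta>) \<le> tweight p t * (walk p (n - m) (n - m) / walk p n (n - 1))"
        using tweight_nonneg[of p t, OF p_nonneg] by (rule mult_left_mono)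
      also have "\<dots> = pmf (H_Tn p n k) a"
        unfolding a m_def using wpos valid m
        by (intro pmf_H_Tn[symmetric] p_nonneg) (auto simp: m_def)
      finally show "(1 - \<delta>) * pmf (map_pmf Some (Hstar p k)) a \<le> pmf (H_Tn p n k) a"
        unfolding Q by (simp add: mult.commute)
    next
      have "measure_pmf.prob (map_pmf Some (Hstar p k)) (- Some ` A)
          = measure_pmf.prob (Hstar p k) (Some -` (- Some ` A))" by simp
      also have "\<dots> = measure_pmf.prob (Hstar p k) (Some -` (- Some ` A) \<inter> set_pmf (Hstar p k))"
        by (rule measure_Int_set_pmf[symmetric])
      also have "\<dots> \<le> measure_pmf.prob (Hstar p k) {tv. real n / 2 < real (tsize (fst tv))}"
        by (intro measure_pmf.finite_measure_mono) (auto simp: A_def)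
      also have "\<dots> \<le> C * (real k + 1) / sqrt n" using n2 by (intro C) auto
      finally show "measure_pmf.prob (map_pmf Some (Hstar p k)) (- Some ` A) \<le> C * (real k + 1) / sqrt n" .
    qed (use assms in auto)
  qed
  then show thesis using that[OF C(1)] by blast
qed

end

theorem theorem5p2:
  fixes w :: "nat \<Rightarrow> real" and \<rho> \<nu> :: ereal and \<tau> :: real and k :: "nat \<Rightarrow> nat"
  assumes ws: "weight_sequence w"
    and rho: "\<rho> = conv_radius w"
    and nu: "((\<lambda>t::ereal. ereal (psi w (real_of_ereal t))) \<longlongrightarrow> \<nu>) (at_left \<rho>)"
    and typeI: "\<rho> > 0" "\<nu> \<ge> 1"
    and tau_pos: "0 < \<tau>" and tau_le: "ereal \<tau> \<le> \<rho>"
    and tau_summ: "summable (\<lambda>j. w j * \<tau> ^ j)" "summable (\<lambda>j. real j * w j * \<tau> ^ j)"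
    and tau: "psi w \<tau> = 1"
    and var: "summable (\<lambda>j. (real j)\<^sup>2 * offspring w \<tau> j)"
    and kn: "(\<lambda>n. real (k n) / sqrt (real n)) \<longlonglongrightarrow> 0"
  shows "\<forall>\<epsilon>>0. \<exists>N. \<forall>n\<ge>N. n mod span w = 1 mod span w \<longrightarrow>
           dTV (H_Tn w n (k n)) (map_pmf Some (Hstar (offspring w \<tau>) (k n))) < \<epsilon>"
proof (intro allI impI)
  fix \<epsilon> :: real assume "0 < \<epsilon>"
  have w: "0 \<le> w j" "0 < w 0" for j using ws by (auto simp: weight_sequence_def)
  have phi: "0 < phi w \<tau>" unfolding phi_def
    by (rule suminf_pos2[OF tau_summ(1), of 0]) (use w tau_pos in auto)
  \<comment> \<open>The term j = 0 vanishes whatever the truncated exponent j - 1 is, so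
    multiplication by tau gives the series of j w_j tau^j. Then psi = 1 says that the tilted law has
    mean 1.\<close>
  have "\<tau> * dphi w \<tau> = (\<Sum>j. \<tau> * (real j * w j * \<tau> ^ (j - 1)))"
    unfolding dphi_def
  proof (rule suminf_mult[symmetric])
    have "summable (\<lambda>j. (real j * w j * \<tau> ^ j) / \<tau>)" using tau_summ(2) by (rule summable_divide)
    also have "(\<lambda>j. (real j * w j * \<tau> ^ j) / \<tau>) = (\<lambda>j. real j * w j * \<tau> ^ (j - 1))"
    proof
      fix j show "(real j * w j * \<tau> ^ j) / \<tau> = real j * w j * \<tau> ^ (j - 1)"
        using tau_pos by (cases j) auto
    qed
    finally show "summable (\<lambda>j. real j * w j * \<tau> ^ (j - 1))" .
  qed
  also have "(\<lambda>j. \<tau> * (real j * w j * \<tau> ^ (j - 1))) = (\<lambda>j. real j * w j * \<tau> ^ j)"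
  proof
    fix j show "\<tau> * (real j * w j * \<tau> ^ (j - 1)) = real j * w j * \<tau> ^ j"
      by (cases j) auto
  qed
  finally have mean: "(\<Sum>j. real j * w j * \<tau> ^ j) = phi w \<tau>"
    using tau phi by (simp add: psi_def field_simps)
  interpret critical_offspring "offspring w \<tau>" "span w"
  proof
    show "0 \<le> offspring w \<tau> j" for j using w tau_pos phi by (simp add: offspring_def)
    show "0 < offspring w \<tau> 0" using w tau_pos phi by (simp add: offspring_def)
    have "(\<lambda>j. w j * \<tau> ^ j / phi w \<tau>) sums (phi w \<tau> / phi w \<tau>)"
      unfolding phi_def by (intro sums_divide summable_sums tau_summ)
    then show "offspring w \<tau> sums 1" using phi by (simp add: offspring_def[abs_def] mult.commute)
    have "(\<lambda>j. real j * w j * \<tau> ^ j / phi w \<tau>) sums (phi w \<tau> / phi w \<tau>)"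
      using summable_sums[OF tau_summ(2)] unfolding mean by (rule sums_divide)
    then show "(\<lambda>j. real j * offspring w \<tau> j) sums 1"
      using phi by (simp add: offspring_def[abs_def] mult_ac)
    show "summable (\<lambda>j. (real j)\<^sup>2 * offspring w \<tau> j)" by (rule var)
    have "0 < offspring w \<tau> j \<longleftrightarrow> 0 < w j" for j
      using tau_pos phi by (simp add: offspring_def zero_less_mult_iff zero_less_divide_iff)
    then show "span w = Gcd {j. 0 < offspring w \<tau> j}" by (simp add: span_def)
  qed
  \<comment> \<open>\<open>dTV_Hstar_le\<close> asks for delta <= 1; the other half of epsilon is
    left for the term containing \<open>k n\<close>.\<close>
  define \<delta> where "\<delta> = min 1 (\<epsilon> / 2)"
  have \<delta>: "0 < \<delta>" "\<delta> \<le> 1" "\<delta> \<le> \<epsilon> / 2" using \<open>0 < \<epsilon>\<close> by (auto simp: \<delta>_def)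
  obtain N C where C: "0 < C" "\<And>n k. N \<le> n \<Longrightarrow> span w dvd n - 1 \<Longrightarrow>
      dTV (H_Tn (offspring w \<tau>) n k) (map_pmf Some (Hstar (offspring w \<tau>) k)) \<le> C * (real k + 1) / sqrt n + \<delta>"
    by (rule dTV_Hstar_le[OF \<delta>(1,2)]) blast
  have "(\<lambda>n. 1 / sqrt (real n)) \<longlonglongrightarrow> 0"
    by (intro tendsto_divide_0[OF tendsto_const] filterlim_at_top_imp_at_infinity
          filterlim_compose[OF sqrt_at_top filterlim_real_sequentially])
  then have "(\<lambda>n. C * (real (k n) / sqrt n + 1 / sqrt n)) \<longlonglongrightarrow> C * (0 + 0)"
    by (intro tendsto_mult tendsto_add tendsto_const kn)
  then have "eventually (\<lambda>n. C * (real (k n) / sqrt n + 1 / sqrt n) < \<epsilon> / 2) sequentially"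
    using \<open>0 < \<epsilon>\<close> by (intro order_tendstoD(2)) auto
  then obtain N' where N': "\<And>n. N' \<le> n \<Longrightarrow> C * (real (k n) / sqrt n + 1 / sqrt n) < \<epsilon> / 2"
    by (auto simp: eventually_sequentially)
  show "\<exists>N. \<forall>n\<ge>N. n mod span w = 1 mod span w \<longrightarrow>
      dTV (H_Tn w n (k n)) (map_pmf Some (Hstar (offspring w \<tau>) (k n))) < \<epsilon>"
  \<comment> \<open>The entry 1 ensures n >= 1, so that the congruence says that the span divides
    the untruncated n - 1.\<close>
  proof (intro exI[of _ "max 1 (max N N')"] allI impI)
    fix n assume n: "max 1 (max N N') \<le> n" "n mod span w = 1 mod span w"
    then have "span w dvd n - 1" using mod_eq_dvd_iff_nat[of 1 n "span w"] by simp
    then have "dTV (H_Tn (offspring w \<tau>) n (k n)) (map_pmf Some (Hstar (offspring w \<tau>) (k n)))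
        \<le> C * (real (k n) + 1) / sqrt n + \<delta>" using n by (intro C) auto
    also have "C * (real (k n) + 1) / sqrt n = C * (real (k n) / sqrt n + 1 / sqrt n)"
      by (simp add: algebra_simps add_divide_distrib)
    also have "\<dots> + \<delta> < \<epsilon> / 2 + \<epsilon> / 2" using n \<delta>(3) by (intro add_less_le_mono N') auto
    also have "\<dots> = \<epsilon>" by simp
    \<comment> \<open>The tilted and the original weights define the same conditioned tree.\<close>
    finally show "dTV (H_Tn w n (k n)) (map_pmf Some (Hstar (offspring w \<tau>) (k n))) < \<epsilon>"
      using tau_pos phi by (simp add: H_Tn_def Tn_offspring)
  qed
qed

end
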